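(* Let $E$ be a $\sigma$-Dedekind complete Banach lattice. The following assertions are equivalent: (1) $E$ has the disjoint weak$^{\star}$ Dunford-Pettis property. (2) Every operator $T:E\to c_0$ is M-weakly compact. (3) Every operator $T:E\to c_0$ is uaw-Dunford-Pettis.
   Context: "Operator" means bounded linear map. A Banach lattice $E$ has the disjoint weak$^{\star}$ Dunford-Pettis property if $\lim_{n\to\infty} f_n(x_n)=0$ for every norm bounded disjoint sequence $(x_n)$ in $E$ and every weak$^{\star}$ null sequence $(f_n)$ in the dual $E'$. An operator $T$ from a Banach lattice $E$ to a Banach space $Y$ is M-weakly compact if $\|Tx_n\|\to 0$ for every norm bounded disjoint sequence $(x_n)$ in $E$. A sequence $(x_n)$ in $E$ is uaw-convergent to $x$, written $x_n\overset{uaw}{\longrightarrow}x$, if $|x_n-x|\wedge u\to0$ weakly for every $u\in E^+$. An operator $T:E\to Y$ is uaw-Dunford-Pettis if $\|Tx_n\|\to0$ for every norm bounded sequence $(x_n)$ in $E$ with $x_n\overset{uaw}{\longrightarrow}0$. *)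

theory Defs
  imports "HOL-Analysis.Analysis" "HOL-Library.Lattice_Algebras"
begin

(* Real Banach lattices.  The class lattice_ab_group_add_abs supplies the lattice operations
   inf and sup together with \<bar>a\<bar> = sup a (- a). *)

class banach_lattice = banach + ordered_real_vector + lattice_ab_group_add_abs +
  assumes lattice_norm: "\<bar>a\<bar> \<le> \<bar>b\<bar> \<Longrightarrow> norm a \<le> norm b"

instance real :: banach_lattice
  by standard simp

(* The sequence x enumerates an arbitrary nonempty countable set that is bounded above. *)

definition sigma_dedekind_complete :: "'a::banach_lattice itself \<Rightarrow> bool" where
  "sigma_dedekind_complete _ \<longleftrightarrow>
     (\<forall>x :: nat \<Rightarrow> 'a. (\<exists>u. \<forall>n. x n \<le> u) \<longrightarrow>
        (\<exists>s. (\<forall>n. x n \<le> s) \<and> (\<forall>u. (\<forall>n. x n \<le> u) \<longrightarrow> s \<le> u)))"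

definition disjoint_seq :: "(nat \<Rightarrow> 'a::banach_lattice) \<Rightarrow> bool" where
  "disjoint_seq x \<longleftrightarrow> (\<forall>m n. m \<noteq> n \<longrightarrow> inf \<bar>x m\<bar> \<bar>x n\<bar> = 0)"

definition weakly_tendsto :: "(nat \<Rightarrow> 'a::real_normed_vector) \<Rightarrow> 'a \<Rightarrow> bool" where
  "weakly_tendsto x a \<longleftrightarrow>
     (\<forall>f :: 'a \<Rightarrow>\<^sub>L real. (\<lambda>n. blinfun_apply f (x n)) \<longlonglongrightarrow> blinfun_apply f a)"

definition weak_star_null :: "(nat \<Rightarrow> 'a::real_normed_vector \<Rightarrow>\<^sub>L real) \<Rightarrow> bool" where
  "weak_star_null f \<longleftrightarrow> (\<forall>a. (\<lambda>n. blinfun_apply (f n) a) \<longlonglongrightarrow> 0)"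

definition uaw_tendsto :: "(nat \<Rightarrow> 'a::banach_lattice) \<Rightarrow> 'a \<Rightarrow> bool" where
  "uaw_tendsto x a \<longleftrightarrow> (\<forall>u\<ge>0. weakly_tendsto (\<lambda>n. inf \<bar>x n - a\<bar> u) 0)"

definition disjoint_weak_star_DP :: "'a::banach_lattice itself \<Rightarrow> bool" where
  "disjoint_weak_star_DP _ \<longleftrightarrow>
     (\<forall>(x :: nat \<Rightarrow> 'a) (f :: nat \<Rightarrow> 'a \<Rightarrow>\<^sub>L real).
        bounded (range x) \<longrightarrow> disjoint_seq x \<longrightarrow> weak_star_null f \<longrightarrow>
        (\<lambda>n. blinfun_apply (f n) (x n)) \<longlonglongrightarrow> 0)"

definition M_weakly_compact :: "('a::banach_lattice \<Rightarrow>\<^sub>L 'b::banach) \<Rightarrow> bool" where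
  "M_weakly_compact T \<longleftrightarrow>
     (\<forall>x :: nat \<Rightarrow> 'a. bounded (range x) \<longrightarrow> disjoint_seq x \<longrightarrow>
        (\<lambda>n. norm (blinfun_apply T (x n))) \<longlonglongrightarrow> 0)"

definition uaw_Dunford_Pettis :: "('a::banach_lattice \<Rightarrow>\<^sub>L 'b::banach) \<Rightarrow> bool" where
  "uaw_Dunford_Pettis T \<longleftrightarrow>
     (\<forall>x :: nat \<Rightarrow> 'a. bounded (range x) \<longrightarrow> uaw_tendsto x 0 \<longrightarrow>
        (\<lambda>n. norm (blinfun_apply T (x n))) \<longlonglongrightarrow> 0)"

typedef c0 = "{x :: nat \<Rightarrow> real. x \<longlonglongrightarrow> 0}"
  morphisms c0_nth Abs_c0
  by (rule exI[of _ "\<lambda>_. 0"]) simp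

setup_lifting type_definition_c0

lemma c0_nth_tendsto: "c0_nth x \<longlonglongrightarrow> 0"
  using c0_nth[of x] by simp

lemma c0_eqI: "(\<And>n. c0_nth x n = c0_nth y n) \<Longrightarrow> x = y"
  by (simp add: c0_nth_inject[symmetric] fun_eq_iff)

instantiation c0 :: real_vector
begin

lift_definition zero_c0 :: c0 is "\<lambda>_. 0" by simp
lift_definition plus_c0 :: "c0 \<Rightarrow> c0 \<Rightarrow> c0" is "\<lambda>x y n. x n + y n"
  by (rule tendsto_add_zero)
lift_definition minus_c0 :: "c0 \<Rightarrow> c0 \<Rightarrow> c0" is "\<lambda>x y n. x n - y n"
  using tendsto_diff by fastforce
lift_definition uminus_c0 :: "c0 \<Rightarrow> c0" is "\<lambda>x n. - x n"
  using tendsto_minus by fastforce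
lift_definition scaleR_c0 :: "real \<Rightarrow> c0 \<Rightarrow> c0" is "\<lambda>r x n. r * x n"
  by (rule tendsto_mult_right_zero)

instance
  by standard (transfer; simp add: algebra_simps fun_eq_iff)+

end

lemmas c0_nth_simps [simp] =
  zero_c0.rep_eq plus_c0.rep_eq minus_c0.rep_eq uminus_c0.rep_eq scaleR_c0.rep_eq

instantiation c0 :: real_normed_vector
begin

definition norm_c0 :: "c0 \<Rightarrow> real" where "norm_c0 x = (SUP n. \<bar>c0_nth x n\<bar>)"
definition dist_c0 :: "c0 \<Rightarrow> c0 \<Rightarrow> real" where "dist_c0 x y = norm (x - y)"
definition sgn_c0 :: "c0 \<Rightarrow> c0" where "sgn_c0 x = x /\<^sub>R norm x"
definition uniformity_c0 :: "(c0 \<times> c0) filter" where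
  "uniformity_c0 = (INF e\<in>{0<..}. principal {(x, y). dist x y < e})"
definition open_c0 :: "c0 set \<Rightarrow> bool" where
  "open_c0 U = (\<forall>x\<in>U. eventually (\<lambda>(x', y). x' = x \<longrightarrow> y \<in> U) uniformity)"

lemma c0_nth_le_norm: "\<bar>c0_nth x n\<bar> \<le> norm x"
proof -
  have "Bseq (c0_nth x)"
    using c0_nth_tendsto convergentI convergent_imp_Bseq by blast
  then have "bdd_above (range (\<lambda>n. \<bar>c0_nth x n\<bar>))"
    by (auto simp: Bseq_def bdd_above_def)
  then show ?thesis
    unfolding norm_c0_def by (rule cSUP_upper[OF UNIV_I])
qed

lemma norm_c0_leI: "(\<And>n. \<bar>c0_nth x n\<bar> \<le> B) \<Longrightarrow> norm x \<le> B"
  unfolding norm_c0_def by (rule cSUP_least) auto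

instance
proof
  fix x y :: c0 and a :: real
  show "dist x y = norm (x - y)" by (rule dist_c0_def)
  show "sgn x = x /\<^sub>R norm x" by (rule sgn_c0_def)
  show "uniformity = (INF e\<in>{0<..}. principal {(x, y :: c0). dist x y < e})"
    by (rule uniformity_c0_def)
  show "open U \<longleftrightarrow> (\<forall>x\<in>U. eventually (\<lambda>(x', y). x' = x \<longrightarrow> y \<in> U) uniformity)"
    for U :: "c0 set" by (rule open_c0_def)
  show "norm x = 0 \<longleftrightarrow> x = 0"
  proof
    assume "norm x = 0"
    then have "c0_nth x n = c0_nth 0 n" for n using c0_nth_le_norm[of x n] by simp
    then show "x = 0" by (rule c0_eqI)
  next
    assume "x = 0"
    then show "norm x = 0" by (simp add: norm_c0_def)
  qed
  show "norm (x + y) \<le> norm x + norm y"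
  proof (rule norm_c0_leI)
    fix n
    show "\<bar>c0_nth (x + y) n\<bar> \<le> norm x + norm y"
      using c0_nth_le_norm[of x n] c0_nth_le_norm[of y n] by simp
  qed
  have le: "norm (b *\<^sub>R z) \<le> \<bar>b\<bar> * norm z" for b and z :: c0
    by (rule norm_c0_leI) (simp add: abs_mult mult_left_mono c0_nth_le_norm)
  show "norm (a *\<^sub>R x) = \<bar>a\<bar> * norm x"
  proof (cases "a = 0")
    case True
    then show ?thesis by (simp add: norm_c0_def)
  next
    case False
    have "norm x \<le> \<bar>inverse a\<bar> * norm (a *\<^sub>R x)"
      using le[of "inverse a" "a *\<^sub>R x"] False by simp
    then have "\<bar>a\<bar> * norm x \<le> norm (a *\<^sub>R x)"
      using False by (simp add: field_simps)
    then show ?thesis using le[of a x] by simp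
  qed
qed

end

instance c0 :: banach
proof
  fix X :: "nat \<Rightarrow> c0"
  assume X: "Cauchy X"
  have coord: "\<bar>c0_nth (X m) k - c0_nth (X n) k\<bar> \<le> dist (X m) (X n)" for m n k
    using c0_nth_le_norm[of "X m - X n" k] by (simp add: dist_norm)
  define l where "l k = lim (\<lambda>n. c0_nth (X n) k)" for k
  have "Cauchy (\<lambda>n. c0_nth (X n) k)" for k
  proof (rule metric_CauchyI)
    fix e :: real assume "e > 0"
    then obtain M where "\<forall>m\<ge>M. \<forall>n\<ge>M. dist (X m) (X n) < e"
      using metric_CauchyD[OF X] by blast
    then show "\<exists>M. \<forall>m\<ge>M. \<forall>n\<ge>M. dist (c0_nth (X m) k) (c0_nth (X n) k) < e"
      unfolding dist_real_def by (intro exI[of _ M] allI impI le_less_trans[OF coord]) simp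
  qed
  then have l: "(\<lambda>n. c0_nth (X n) k) \<longlonglongrightarrow> l k" for k
    unfolding l_def using Cauchy_convergent convergent_LIMSEQ_iff by blast
  have unif: "\<exists>N. \<forall>n\<ge>N. \<forall>k. \<bar>c0_nth (X n) k - l k\<bar> \<le> e" if "e > 0" for e
  proof -
    obtain N where N: "\<And>m n. m \<ge> N \<Longrightarrow> n \<ge> N \<Longrightarrow> dist (X m) (X n) < e"
      using metric_CauchyD[OF X \<open>e > 0\<close>] by blast
    have "\<bar>c0_nth (X n) k - l k\<bar> \<le> e" if "n \<ge> N" for n k
    proof (rule tendsto_upperbound)
      show "(\<lambda>m. \<bar>c0_nth (X n) k - c0_nth (X m) k\<bar>) \<longlonglongrightarrow> \<bar>c0_nth (X n) k - l k\<bar>"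
        by (intro tendsto_intros l)
      show "\<forall>\<^sub>F m in sequentially. \<bar>c0_nth (X n) k - c0_nth (X m) k\<bar> \<le> e"
        unfolding eventually_sequentially
      proof (intro exI[of _ N] allI impI)
        fix m assume "N \<le> m"
        show "\<bar>c0_nth (X n) k - c0_nth (X m) k\<bar> \<le> e"
          using coord[of n k m] N[OF \<open>n \<ge> N\<close> \<open>N \<le> m\<close>] by linarith
      qed
    qed simp
    then show ?thesis by blast
  qed
  have "l \<longlonglongrightarrow> 0"
  proof (rule LIMSEQ_I)
    fix e :: real assume "e > 0"
    then obtain N where N: "\<And>k. \<bar>c0_nth (X N) k - l k\<bar> \<le> e / 2"
      using unif[of "e / 2"] by auto
    obtain K where K: "\<And>k. k \<ge> K \<Longrightarrow> \<bar>c0_nth (X N) k\<bar> < e / 2"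
      using LIMSEQ_D[OF c0_nth_tendsto, of "e / 2" "X N"] \<open>e > 0\<close> by auto
    have "\<bar>l k\<bar> < e" if "k \<ge> K" for k
      using N[of k] K[OF that] by linarith
    then show "\<exists>no. \<forall>n\<ge>no. norm (l n - 0) < e" by auto
  qed
  then have nth_l: "c0_nth (Abs_c0 l) = l" by (simp add: Abs_c0_inverse)
  have "X \<longlonglongrightarrow> Abs_c0 l"
  proof (rule LIMSEQ_I)
    fix e :: real assume "e > 0"
    then obtain N where N: "\<And>n k. n \<ge> N \<Longrightarrow> \<bar>c0_nth (X n) k - l k\<bar> \<le> e / 2"
      using unif[of "e / 2"] by auto
    have le: "norm (X n - Abs_c0 l) \<le> e / 2" if "n \<ge> N" for n
      by (rule norm_c0_leI) (use N[OF that] in \<open>simp add: nth_l\<close>)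
    have "norm (X n - Abs_c0 l) < e" if "n \<ge> N" for n
      using le[OF that] \<open>e > 0\<close> by linarith
    then show "\<exists>no. \<forall>n\<ge>no. norm (X n - Abs_c0 l) < e"
      by blast
  qed
  then show "convergent X" by (rule convergentI)
qed

end

theory Submission
  imports Defs
begin

text \<open>
  The point is a vector-valued form of Phillips' lemma. Let \<open>E\<close> be \<open>\<sigma>\<close>-Dedekind complete,
  \<open>T : E \<rightarrow> c\<^sub>0\<close>, and let \<open>v\<^sub>k \<ge> 0\<close> have partial sums bounded above; then \<open>T v\<^sub>k \<rightarrow> 0\<close> in norm.
  Order sums over all index sets exist, and a gliding hump along index sets on which the
  purely finitely additive parts of the coordinates of \<open>T\<close> are small gives a contradiction.
  A Vitali-Hahn-Saks argument in the lattice then shows that \<open>T y\<^sub>n \<rightarrow> 0\<close> in norm for every positive,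
  order bounded, weakly null sequence \<open>y\<close>.

  (2) implies (3): M-weak compactness makes \<open>\<parallel>T (x\<^sub>n - u)\<^sup>+\<parallel>\<close> uniformly small for some \<open>u\<close>, and the
  remaining parts \<open>x\<^sub>n \<sqinter> u\<close> are order bounded and weakly null. (3) implies (2) because disjoint
  sequences are uaw-null. (1) implies (2): under (1) each functional \<open>f\<close> tends to 0 along a bounded
  disjoint sequence \<open>x\<close>, since the components of \<open>\<bar>f\<bar>\<close> carried by the \<open>\<bar>x\<^sub>n\<bar>\<close> form a
  weak-star null sequence; hence coordinates of \<open>T\<close> that are large at \<open>x\<^sub>n\<close> have indices tending to
  infinity and are themselves weak-star null. (2) implies (1) because a weak-star null sequence is,
  by uniform boundedness, the coordinate sequence of an operator into \<open>c\<^sub>0\<close>.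
\<close>

section \<open>Lattice inequalities\<close>

text \<open>By translation invariance the right-hand side is the infimum of the four sums
  \<open>x + x\<close>, \<open>y + x\<close>, \<open>x + z\<close> and \<open>y + z\<close>, each of
  which dominates the left-hand side.\<close>

lemma inf_add_le:
  fixes x y z :: "'a::lattice_ab_group_add"
  assumes "0 \<le> x" "0 \<le> y" "0 \<le> z"
  shows "inf x (y + z) \<le> inf x y + inf x z"
proof -
  have "inf x (y + z) \<le> x + x" "inf x (y + z) \<le> y + x" "inf x (y + z) \<le> x + z"
    using assms by (auto intro: le_infI1 add_increasing add_increasing2)
  then show ?thesis
    by (simp add: add_inf_distrib_left add_inf_distrib_right)
qed

lemma diff_inf_eq_pos: "x - inf x v = sup (x - v) 0" for x v :: "'a::lattice_ab_group_add"
  by (simp add: add_sup_distrib_left sup_commute)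

text \<open>Riesz decomposition: \<open>a\<close> is the truncation \<open>inf x v\<close>, and the
  remainder is the positive part of \<open>x - v\<close>, which is below \<open>w\<close>.\<close>

lemma riesz_split:
  fixes x v w :: "'a::lattice_ab_group_add"
  assumes "0 \<le> x" "x \<le> v + w" "0 \<le> v" "0 \<le> w"
  obtains a b where "x = a + b" "0 \<le> a" "a \<le> v" "0 \<le> b" "b \<le> w"
proof
  show "x = inf x v + (x - inf x v)" by (simp del: diff_inf_eq_sup)
  show "0 \<le> x - inf x v" "x - inf x v \<le> w"
    unfolding diff_inf_eq_pos using assms by (auto simp: algebra_simps)
qed (use assms in auto)

lemma inf_sum_eq_0:
  fixes z :: "nat \<Rightarrow> 'a::lattice_ab_group_add"
  assumes "\<And>i. 0 \<le> z i" "0 \<le> a" "\<And>i. i < n \<Longrightarrow> inf a (z i) = 0"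
  shows "inf a (\<Sum>i<n. z i) = 0"
  using assms(3)
proof (induction n)
  case 0
  then show ?case using assms by (simp add: inf_absorb2)
next
  case (Suc n)
  have "inf a (\<Sum>i<Suc n. z i) \<le> inf a (\<Sum>i<n. z i) + inf a (z n)"
    unfolding sum.lessThan_Suc by (intro inf_add_le sum_nonneg assms)
  also have "\<dots> = 0" using Suc by simp
  finally show ?case
    using assms by (intro antisym le_infI sum_nonneg) auto
qed

text \<open>Since \<open>a + b = inf a b + sup a b\<close>, a sum of disjoint elements is their
  supremum.\<close>

lemma disjoint_sum_le:
  fixes z :: "nat \<Rightarrow> 'a::lattice_ab_group_add"
  assumes "\<And>i. 0 \<le> z i" "\<And>i. z i \<le> u" "0 \<le> u" "\<And>i j. i \<noteq> j \<Longrightarrow> inf (z i) (z j) = 0"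
  shows "(\<Sum>i<n. z i) \<le> u"
proof (induction n)
  case (Suc n)
  have "inf (z n) (\<Sum>i<n. z i) = 0"
    by (rule inf_sum_eq_0) (auto simp: assms)
  then have "(\<Sum>i<Suc n. z i) = sup (\<Sum>i<n. z i) (z n)"
    using add_eq_inf_sup[of "\<Sum>i<n. z i" "z n"] by (simp add: inf_commute)
  with Suc assms show ?case by simp
qed (simp add: assms)

lemma inf_scaleR:
  fixes a b :: "'a::{ordered_real_vector,lattice}"
  assumes "0 < c"
  shows "c *\<^sub>R inf a b = inf (c *\<^sub>R a) (c *\<^sub>R b)"
proof (rule antisym)
  show "c *\<^sub>R inf a b \<le> inf (c *\<^sub>R a) (c *\<^sub>R b)"
    using assms by (simp add: scaleR_left_mono)
  have "(1 / c) *\<^sub>R inf (c *\<^sub>R a) (c *\<^sub>R b) \<le> inf a b"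
    using assms scaleR_left_mono[of "inf (c *\<^sub>R a) (c *\<^sub>R b)" "c *\<^sub>R a" "1/c"]
      scaleR_left_mono[of "inf (c *\<^sub>R a) (c *\<^sub>R b)" "c *\<^sub>R b" "1/c"] by simp
  from scaleR_left_mono[OF this, of c] assms
  show "inf (c *\<^sub>R a) (c *\<^sub>R b) \<le> c *\<^sub>R inf a b" by simp
qed

lemma inf_scaleR_eq_0:
  fixes a b :: "'a::banach_lattice"
  assumes "0 \<le> a" "0 \<le> b" "inf a b = 0" "0 \<le> c" "0 \<le> d"
  shows "inf (c *\<^sub>R a) (d *\<^sub>R b) = 0"
proof -
  \<comment> \<open>Both factors are enlarged to a common one; the summand 1 keeps it positive, as
    \<open>inf_scaleR\<close> requires.\<close>
  have "inf (c *\<^sub>R a) (d *\<^sub>R b) \<le> inf ((c + d + 1) *\<^sub>R a) ((c + d + 1) *\<^sub>R b)"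
    using assms by (intro inf_mono scaleR_right_mono) auto
  also have "\<dots> = 0" using assms by (simp flip: inf_scaleR)
  finally show ?thesis
    using assms by (intro antisym) (auto intro: scaleR_nonneg_nonneg)
qed

lemma norm_mono_pos: "0 \<le> a \<Longrightarrow> a \<le> b \<Longrightarrow> norm a \<le> norm b" for a b :: "'a::banach_lattice"
  by (rule lattice_norm) simp

lemma norm_abs [simp]: "norm \<bar>a\<bar> = norm a" for a :: "'a::banach_lattice"
  by (intro antisym lattice_norm) simp_all

lemma norm_sup_0_le: "norm (sup a 0) \<le> norm a" for a :: "'a::banach_lattice"
proof (rule lattice_norm)
  have "\<bar>sup a 0\<bar> = sup a 0" by (rule abs_of_nonneg) simp
  then show "\<bar>sup a 0\<bar> \<le> \<bar>a\<bar>" by (simp add: abs_ge_self)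
qed

section \<open>Functionals\<close>

text \<open>With signs \<open>e i\<close> the left-hand side becomes the value of \<open>f\<close>
  at a single element, whose modulus is at most \<open>u\<close>.\<close>

lemma abs_sum_le:
  fixes v :: "'i \<Rightarrow> 'a::banach_lattice"
  assumes v: "\<And>i. i \<in> I \<Longrightarrow> 0 \<le> v i" and u: "(\<Sum>i\<in>I. v i) \<le> u" and I: "finite I"
  shows "(\<Sum>i\<in>I. \<bar>blinfun_apply f (v i)\<bar>) \<le> norm f * norm u"
proof -
  define e where "e i = sgn (blinfun_apply f (v i))" for i
  have "(\<Sum>i\<in>I. \<bar>blinfun_apply f (v i)\<bar>) = blinfun_apply f (\<Sum>i\<in>I. e i *\<^sub>R v i)"
    unfolding blinfun.sum_right blinfun.scaleR_right e_def by (simp add: abs_sgn mult.commute)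
  also have "\<dots> \<le> norm f * norm (\<Sum>i\<in>I. e i *\<^sub>R v i)"
    using norm_blinfun[of f] by (metis abs_ge_self order_trans real_norm_def)
  also have "norm (\<Sum>i\<in>I. e i *\<^sub>R v i) \<le> norm u"
  proof (rule lattice_norm)
    have "\<bar>e i *\<^sub>R v i\<bar> \<le> v i" if "i \<in> I" for i
      using v[OF that] by (auto simp: e_def sgn_if)
    then have "(\<Sum>i\<in>I. \<bar>e i *\<^sub>R v i\<bar>) \<le> (\<Sum>i\<in>I. v i)" by (rule sum_mono)
    with sum_abs[of "\<lambda>i. e i *\<^sub>R v i" I] u
    show "\<bar>\<Sum>i\<in>I. e i *\<^sub>R v i\<bar> \<le> \<bar>u\<bar>" by (meson abs_ge_self order_trans)
  qed
  finally show ?thesis by (simp add: mult_left_mono)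
qed

text \<open>By \<open>abs_sum_le\<close> the values of \<open>f\<close> form an absolutely summable
  series.\<close>

lemma order_bounded_sum_tendsto_0:
  fixes v :: "nat \<Rightarrow> 'a::banach_lattice" and f :: "'a \<Rightarrow>\<^sub>L real"
  assumes v: "\<And>i. 0 \<le> v i" and u: "\<And>n. (\<Sum>i<n. v i) \<le> u"
  shows "(\<lambda>i. blinfun_apply f (v i)) \<longlonglongrightarrow> 0"
proof -
  have "(\<Sum>i\<le>n. \<bar>blinfun_apply f (v i)\<bar>) \<le> norm f * norm u" for n
    using v u[of "Suc n"] by (intro abs_sum_le) (auto simp only: lessThan_Suc_atMost)
  then have "summable (\<lambda>i. \<bar>blinfun_apply f (v i)\<bar>)"
    by (intro bounded_imp_summable) auto
  then show ?thesis
    using summable_LIMSEQ_zero tendsto_rabs_zero_iff by blast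
qed

text \<open>The defect \<open>h\<close> of homogeneity along \<open>x\<close> is additive and
  vanishes at the integers, so it has period 1 and is bounded. A bounded additive function is zero,
  because \<open>h (n * c) = n * h c\<close>.\<close>

lemma additive_bounded_scaleR:
  fixes g :: "'a::real_normed_vector \<Rightarrow> real"
  assumes add: "\<And>x y. g (x + y) = g x + g y" and bd: "\<And>x. \<bar>g x\<bar> \<le> C * norm x"
  shows "g (c *\<^sub>R x) = c * g x"
proof -
  define h where "h t = g (t *\<^sub>R x) - t * g x" for t
  have h_add: "h (s + t) = h s + h t" for s t
    by (simp add: h_def add algebra_simps)
  have h_nat: "h (real n * t) = real n * h t" for n t
  proof (induction n)
    case 0
    show ?case using h_add[of 0 0] by simp
  next
    case (Suc n)
    then show ?case using h_add[of t "real n * t"] by (simp add: algebra_simps)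
  qed
  have h_1: "h 1 = 0" by (simp add: h_def)
  have h_int: "h (of_int k) = 0" for k
  proof (cases k rule: int_cases2)
    case (nonneg n)
    then show ?thesis using h_nat[of n 1] h_1 by simp
  next
    case (nonpos n)
    then show ?thesis
      using h_nat[of n 1] h_1 h_add[of "real n" "- real n"] h_nat[of 0 0] by simp
  qed
  define B where "B = \<bar>C\<bar> * norm x + \<bar>g x\<bar>"
  have B: "\<bar>h t\<bar> \<le> B" for t
  proof -
    have "h t = h (frac t)"
      using h_add[of "of_int \<lfloor>t\<rfloor>" "frac t"] h_int by (simp add: frac_def)
    also have "\<bar>\<dots>\<bar> \<le> \<bar>g (frac t *\<^sub>R x)\<bar> + frac t * \<bar>g x\<bar>"
      unfolding h_def using frac_ge_0[of t] abs_triangle_ineq4[of "g (frac t *\<^sub>R x)" "frac t * g x"]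
      by (simp add: abs_mult)
    also have "\<bar>g (frac t *\<^sub>R x)\<bar> \<le> \<bar>C\<bar> * (1 * norm x)"
    proof (rule order_trans[OF bd])
      show "C * norm (frac t *\<^sub>R x) \<le> \<bar>C\<bar> * (1 * norm x)"
        using frac_ge_0[of t] frac_lt_1[of t] by (intro mult_mono) (auto intro!: mult_left_le_one_le)
    qed
    also have "frac t * \<bar>g x\<bar> \<le> 1 * \<bar>g x\<bar>"
      using frac_lt_1[of t] by (intro mult_right_mono) auto
    finally show ?thesis by (simp add: B_def)
  qed
  have "h c = 0"
  proof (rule ccontr)
    assume "h c \<noteq> 0"
    then obtain n where "B < real n * \<bar>h c\<bar>"
      using reals_Archimedean3[of "\<bar>h c\<bar>"] by auto
    with B[of "real n * c"] h_nat[of n c] show False by (simp add: abs_mult)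
  qed
  then show ?thesis by (simp add: h_def)
qed

text \<open>The extension is \<open>\<phi>\<close> of the positive part minus \<open>\<phi>\<close>
  of the negative part. Homogeneity follows from additivity and the norm bound through
  \<open>additive_bounded_scaleR\<close>.\<close>

lemma cone_extension:
  fixes \<phi> :: "'a::banach_lattice \<Rightarrow> real"
  assumes add: "\<And>x y. 0 \<le> x \<Longrightarrow> 0 \<le> y \<Longrightarrow> \<phi> (x + y) = \<phi> x + \<phi> y"
    and pos: "\<And>x. 0 \<le> x \<Longrightarrow> 0 \<le> \<phi> x"
    and bd: "\<And>x. 0 \<le> x \<Longrightarrow> \<phi> x \<le> C * norm x"
  obtains g :: "'a \<Rightarrow>\<^sub>L real" where "\<And>x. 0 \<le> x \<Longrightarrow> blinfun_apply g x = \<phi> x"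
proof -
  define g where "g x = \<phi> (pprt x) - \<phi> (pprt (- x))" for x
  have split: "x = pprt x - pprt (- x)" for x :: 'a
    using prts[of x] by (simp add: pprt_neg)
  \<comment> \<open>The value does not depend on how an element is written as a difference of
    positive ones: add crosswise and use additivity on the cone.\<close>
  have g_diff: "g (a - b) = \<phi> a - \<phi> b" if "0 \<le> a" "0 \<le> b" for a b
  proof -
    have "a - b = pprt (a - b) - pprt (- (a - b))" by (rule split)
    then have "a + pprt (- (a - b)) = pprt (a - b) + b" by (simp add: algebra_simps)
    then have "\<phi> a + \<phi> (pprt (- (a - b))) = \<phi> (pprt (a - b)) + \<phi> b"
      using that add zero_le_pprt by metis
    then show ?thesis by (simp add: g_def)
  qed
  have g_add: "g (x + y) = g x + g y" for x y
  proof -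
    have "x + y = (pprt x + pprt y) - (pprt (- x) + pprt (- y))"
      using arg_cong2[OF split[of x] split[of y], of "(+)"] by (simp only: algebra_simps)
    then have "g (x + y) = \<phi> (pprt x + pprt y) - \<phi> (pprt (- x) + pprt (- y))"
      by (metis g_diff add_nonneg_nonneg zero_le_pprt)
    then show ?thesis by (simp add: add g_def)
  qed
  have C: "0 \<le> C * norm x" for x :: 'a
    using bd[of "\<bar>x\<bar>"] pos[of "\<bar>x\<bar>"] by simp
  have g_bd: "\<bar>g x\<bar> \<le> C * norm x" for x
  proof -
    \<comment> \<open>A negative \<open>C\<close> is compatible with the bounds only if every norm
      vanishes.\<close>
    have "C * norm (pprt y) \<le> C * norm y" for y :: 'a
    proof (cases "0 \<le> C")
      case True
      then show ?thesis by (simp add: mult_left_mono norm_sup_0_le pprt_def)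
    next
      case False
      with C[of y] have "norm y = 0" by (simp add: zero_le_mult_iff)
      then show ?thesis by simp
    qed
    from this[of x] this[of "- x"] show ?thesis
      using bd[of "pprt x"] bd[of "pprt (- x)"] pos[of "pprt x"] pos[of "pprt (- x)"]
      by (simp add: g_def)
  qed
  have "bounded_linear g"
    by (rule bounded_linear_intro[where K = C])
      (use g_add additive_bounded_scaleR[OF g_add g_bd] g_bd in \<open>auto simp: mult.commute\<close>)
  moreover have "\<phi> 0 = 0" using add[of 0 0] by simp
  ultimately show ?thesis
    using that[of "Blinfun g"] g_diff[of _ 0] by (simp add: bounded_linear_Blinfun_apply)
qed

text \<open>Riesz-Kantorovich formula: the supremum \<open>\<phi> v\<close> of \<open>f\<close> over
  the order interval from 0 to \<open>v\<close> is additive by Riesz decomposition and extends to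
  the positive part of \<open>f\<close>. Adding the functional obtained from \<open>- f\<close>
  gives a substitute for the modulus.\<close>

lemma functional_dominated:
  fixes f :: "'a::banach_lattice \<Rightarrow>\<^sub>L real"
  obtains g :: "'a \<Rightarrow>\<^sub>L real" where "\<And>x. \<bar>blinfun_apply f x\<bar> \<le> blinfun_apply g \<bar>x\<bar>"
proof -
  have pos_part: "\<exists>g::'a \<Rightarrow>\<^sub>L real. \<forall>x\<ge>0. 0 \<le> blinfun_apply g x \<and> blinfun_apply f x \<le> blinfun_apply g x"
    for f :: "'a \<Rightarrow>\<^sub>L real"
  proof -
    define \<phi> where "\<phi> v = (SUP x\<in>{0..v}. blinfun_apply f x)" for v
    have le: "blinfun_apply f x \<le> norm f * norm v" if "x \<in> {0..v}" for x v
    proof -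
      have "blinfun_apply f x \<le> norm f * norm x"
        using norm_blinfun[of f x] by simp
      also have "\<dots> \<le> norm f * norm v"
        using that by (intro mult_left_mono norm_mono_pos) auto
      finally show ?thesis .
    qed
    then have bdd: "bdd_above (blinfun_apply f ` {0..v})" for v
      by (rule bdd_aboveI2)
    have up: "blinfun_apply f x \<le> \<phi> v" if "0 \<le> x" "x \<le> v" for x v
      unfolding \<phi>_def using that by (intro cSUP_upper bdd) auto
    have least: "\<phi> v \<le> c" if "0 \<le> v" "\<And>x. 0 \<le> x \<Longrightarrow> x \<le> v \<Longrightarrow> blinfun_apply f x \<le> c" for v c
      unfolding \<phi>_def using that by (intro cSUP_least) auto
    have "\<phi> (v + w) = \<phi> v + \<phi> w" if "0 \<le> v" "0 \<le> w" for v w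
    proof (rule antisym)
      show "\<phi> (v + w) \<le> \<phi> v + \<phi> w"
      proof (rule least)
        fix x assume "0 \<le> x" "x \<le> v + w"
        then obtain a b where "x = a + b" "0 \<le> a" "a \<le> v" "0 \<le> b" "b \<le> w"
          using riesz_split \<open>0 \<le> v\<close> \<open>0 \<le> w\<close> by blast
        then show "blinfun_apply f x \<le> \<phi> v + \<phi> w"
          using up[of a v] up[of b w] by (simp add: blinfun.add_right)
      qed (use that in simp)
      have "\<phi> v \<le> \<phi> (v + w) - \<phi> w"
      proof (rule least)
        fix x assume x: "0 \<le> x" "x \<le> v"
        have "\<phi> w \<le> \<phi> (v + w) - blinfun_apply f x"
        proof (rule least)
          fix y assume "0 \<le> y" "y \<le> w"
          then show "blinfun_apply f y \<le> \<phi> (v + w) - blinfun_apply f x"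
            using x up[of "x + y" "v + w"] by (simp add: blinfun.add_right add_mono)
        qed (use that in simp)
        then show "blinfun_apply f x \<le> \<phi> (v + w) - \<phi> w" by simp
      qed (use that in simp)
      then show "\<phi> v + \<phi> w \<le> \<phi> (v + w)" by simp
    qed
    moreover have "0 \<le> \<phi> v" if "0 \<le> v" for v using up[of 0 v] that by simp
    moreover have "\<phi> v \<le> norm f * norm v" if "0 \<le> v" for v using least le that by simp
    ultimately obtain g :: "'a \<Rightarrow>\<^sub>L real" where "\<And>x. 0 \<le> x \<Longrightarrow> blinfun_apply g x = \<phi> x"
      using cone_extension by metis
    with \<open>\<And>v. 0 \<le> v \<Longrightarrow> 0 \<le> \<phi> v\<close> up show ?thesis by (intro exI[of _ g]) auto
  qed
  obtain g h :: "'a \<Rightarrow>\<^sub>L real"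
    where g: "\<And>x. 0 \<le> x \<Longrightarrow> 0 \<le> blinfun_apply g x" "\<And>x. 0 \<le> x \<Longrightarrow> blinfun_apply f x \<le> blinfun_apply g x"
      and h: "\<And>x. 0 \<le> x \<Longrightarrow> 0 \<le> blinfun_apply h x" "\<And>x. 0 \<le> x \<Longrightarrow> - blinfun_apply f x \<le> blinfun_apply h x"
    using pos_part[of f] pos_part[of "- f"] by (auto simp: blinfun.minus_left)
  have pos: "\<bar>blinfun_apply f x\<bar> \<le> blinfun_apply (g + h) x" if "0 \<le> x" for x
    using g[OF that] h[OF that] by (simp add: blinfun.add_left abs_le_iff)
  have "\<bar>blinfun_apply f x\<bar> \<le> blinfun_apply (g + h) \<bar>x\<bar>" for x
  proof -
    have "blinfun_apply f x = blinfun_apply f (pprt x) - blinfun_apply f (pprt (- x))"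
      using prts[of x] by (simp add: pprt_neg flip: blinfun.diff_right)
    moreover have "blinfun_apply (g + h) \<bar>x\<bar>
        = blinfun_apply (g + h) (pprt x) + blinfun_apply (g + h) (pprt (- x))"
      by (simp add: abs_prts pprt_neg flip: blinfun.add_right)
    ultimately show ?thesis
      using pos[of "pprt x"] pos[of "pprt (- x)"] by simp
  qed
  then show ?thesis by (rule that)
qed

text \<open>A functional \<open>g\<close> dominating \<open>f\<close> is positive, hence monotone,
  so \<open>\<bar>f (y n)\<bar>\<close> is at most \<open>g (z n)\<close>.\<close>

lemma weakly_null_dominated:
  fixes y z :: "nat \<Rightarrow> 'a::banach_lattice"
  assumes z: "weakly_tendsto z 0" and le: "\<And>n. \<bar>y n\<bar> \<le> z n"
  shows "weakly_tendsto y 0"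
  unfolding weakly_tendsto_def
proof
  fix f :: "'a \<Rightarrow>\<^sub>L real"
  obtain g :: "'a \<Rightarrow>\<^sub>L real" where g: "\<And>x. \<bar>blinfun_apply f x\<bar> \<le> blinfun_apply g \<bar>x\<bar>"
    using functional_dominated[of f] by blast
  have "blinfun_apply g \<bar>y n\<bar> \<le> blinfun_apply g (z n)" for n
    using g[of "z n - \<bar>y n\<bar>"] le[of n] by (simp add: blinfun.diff_right)
  then have "\<bar>blinfun_apply f (y n)\<bar> \<le> blinfun_apply g (z n)" for n
    using g order_trans by blast
  then have "\<forall>\<^sub>F n in sequentially. norm (blinfun_apply f (y n)) \<le> blinfun_apply g (z n)"
    by (intro always_eventually) simp
  moreover have "(\<lambda>n. blinfun_apply g (z n)) \<longlonglongrightarrow> 0"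
    using z by (simp add: weakly_tendsto_def blinfun.zero_right)
  ultimately show "(\<lambda>n. blinfun_apply f (y n)) \<longlonglongrightarrow> blinfun_apply f 0"
    unfolding blinfun.zero_right by (rule Lim_null_comparison)
qed

section \<open>Weak-star null sequences and operators into $c_0$\<close>

text \<open>Baire category: some closed set \<open>A k\<close> contains a ball around a point
  \<open>a\<close>, and subtracting the value at \<open>a\<close> moves the bound to a ball around
  0.\<close>

lemma uniform_boundedness:
  fixes f :: "nat \<Rightarrow> 'a::banach \<Rightarrow>\<^sub>L 'b::real_normed_vector"
  assumes "\<And>x. bounded (range (\<lambda>n. blinfun_apply (f n) x))"
  obtains K where "\<And>n. norm (f n) \<le> K"
proof -
  define A where "A k = {x. \<forall>n. norm (blinfun_apply (f n) x) \<le> real k}" for k :: nat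
  have closed: "closed (A k)" for k
    unfolding A_def
    by (intro closed_Collect_all closed_Collect_le continuous_intros)
  have "(\<Union>k. A k) = UNIV"
  proof -
    have "\<exists>k. x \<in> A k" for x
    proof -
      obtain B where "\<And>n. norm (blinfun_apply (f n) x) \<le> B"
        using assms[of x] by (auto simp: bounded_iff)
      moreover obtain k where "B \<le> real k" using real_arch_simple by blast
      ultimately show ?thesis unfolding A_def by (blast intro: order_trans)
    qed
    then show ?thesis by auto
  qed
  then have "\<exists>k. interior (A k) \<noteq> {}"
    using Met_TC.metric_Baire_category_alt[of "range A"] closed complete_UNIV by fastforce
  then obtain k a where "a \<in> interior (A k)" by blast
  then obtain r where r: "0 < r" "cball a r \<subseteq> A k"
    by (auto simp: mem_interior_cball)
  have "norm (f n) \<le> 2 * real k / r" for n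
  proof (rule norm_blinfun_bound)
    fix x
    show "norm (blinfun_apply (f n) x) \<le> 2 * real k / r * norm x"
    proof (cases "x = 0")
      case False
      define y where "y = (r / norm x) *\<^sub>R x"
      have y: "norm y = r" using False r by (simp add: y_def)
      have "norm (blinfun_apply (f n) y) = norm (blinfun_apply (f n) (a + y) - blinfun_apply (f n) a)"
        by (simp add: blinfun.add_right)
      also have "\<dots> \<le> real k + real k"
      proof (rule order_trans[OF norm_triangle_ineq4 add_mono])
        have "a + y \<in> A k" "a \<in> A k" using r y by (auto simp: dist_norm subset_eq)
        then show "norm (blinfun_apply (f n) (a + y)) \<le> real k" "norm (blinfun_apply (f n) a) \<le> real k"
          by (simp_all add: A_def)
      qed
      finally show ?thesis
        using False r by (simp add: y_def blinfun.scaleR_right field_simps)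
    qed (simp add: blinfun.zero_right)
  qed (use r in simp)
  then show ?thesis by (rule that)
qed

lemma c0_norm_gt:
  assumes "e < norm x"
  obtains m where "e < \<bar>c0_nth x m\<bar>"
  using norm_c0_leI[of x e] assms by (meson not_le)

definition coord :: "('a::real_normed_vector \<Rightarrow>\<^sub>L c0) \<Rightarrow> nat \<Rightarrow> 'a \<Rightarrow>\<^sub>L real" where
  "coord T m = Blinfun (\<lambda>x. c0_nth (blinfun_apply T x) m)"

lemma coord_apply [simp]: "blinfun_apply (coord T m) x = c0_nth (blinfun_apply T x) m"
proof -
  have "bounded_linear (\<lambda>x. c0_nth x m)"
    by (rule bounded_linear_intro[where K = 1]) (auto simp: c0_nth_le_norm)
  then have "bounded_linear (\<lambda>x. c0_nth (blinfun_apply T x) m)"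
    by (rule bounded_linear_compose) (rule blinfun.bounded_linear_right)
  then show ?thesis by (simp add: coord_def bounded_linear_Blinfun_apply)
qed

lemma weak_star_null_coord: "weak_star_null (coord T)"
  by (simp add: weak_star_null_def c0_nth_tendsto)

lemma weak_star_null_imp_coord:
  fixes f :: "nat \<Rightarrow> 'a::banach \<Rightarrow>\<^sub>L real"
  assumes f: "weak_star_null f"
  obtains T where "coord T = f"
proof -
  have lim: "(\<lambda>n. blinfun_apply (f n) x) \<longlonglongrightarrow> 0" for x
    using f by (simp add: weak_star_null_def)
  obtain K where K: "\<And>n. norm (f n) \<le> K"
    using uniform_boundedness[of f] lim convergent_imp_bounded by metis
  define T where "T x = Abs_c0 (\<lambda>n. blinfun_apply (f n) x)" for x
  have nth: "c0_nth (T x) n = blinfun_apply (f n) x" for x n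
    by (simp add: T_def Abs_c0_inverse lim)
  have "bounded_linear T"
  proof (rule bounded_linear_intro)
    show "norm (T x) \<le> norm x * K" for x
    proof (rule norm_c0_leI)
      fix n
      have "\<bar>blinfun_apply (f n) x\<bar> \<le> norm (f n) * norm x"
        using norm_blinfun[of "f n" x] by simp
      also have "\<dots> \<le> K * norm x" by (intro mult_right_mono K) simp
      finally show "\<bar>c0_nth (T x) n\<bar> \<le> norm x * K" by (simp add: nth mult.commute)
    qed
  qed (auto intro!: c0_eqI simp: nth blinfun.add_right blinfun.scaleR_right)
  then have "coord (Blinfun T) = f"
    by (intro ext blinfun_eqI) (simp add: bounded_linear_Blinfun_apply nth)
  then show ?thesis by (rule that)
qed

text \<open>The functional \<open>g\<close> below is the component of \<open>f\<close> carried by \<open>z\<close>.\<close>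

lemma functional_component:
  fixes f :: "'a::banach_lattice \<Rightarrow>\<^sub>L real" and z :: 'a
  assumes pos: "\<And>x. 0 \<le> x \<Longrightarrow> 0 \<le> blinfun_apply f x" and z: "0 \<le> z"
  obtains g :: "'a \<Rightarrow>\<^sub>L real"
    where "\<And>x t. 0 \<le> x \<Longrightarrow> 0 \<le> t \<Longrightarrow> blinfun_apply f (inf x (t *\<^sub>R z)) \<le> blinfun_apply g x"
      and "\<And>x e. 0 \<le> x \<Longrightarrow> 0 < e \<Longrightarrow>
             \<exists>t\<ge>0. blinfun_apply g x < blinfun_apply f (inf x (t *\<^sub>R z)) + e"
proof -
  have mono: "blinfun_apply f x \<le> blinfun_apply f y" if "x \<le> y" for x y
    using pos[of "y - x"] that by (simp add: blinfun.diff_right)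
  define \<phi> where "\<phi> x = (SUP t\<in>{0..}. blinfun_apply f (inf x (t *\<^sub>R z)))" for x
  have bdd: "bdd_above ((\<lambda>t. blinfun_apply f (inf x (t *\<^sub>R z))) ` {0..})" for x
    by (rule bdd_aboveI2[where M = "blinfun_apply f x"]) (simp add: mono)
  have up: "blinfun_apply f (inf x (t *\<^sub>R z)) \<le> \<phi> x" if "0 \<le> t" for x t
    unfolding \<phi>_def using that by (intro cSUP_upper bdd) auto
  have least: "\<phi> x \<le> c" if "\<And>t. 0 \<le> t \<Longrightarrow> blinfun_apply f (inf x (t *\<^sub>R z)) \<le> c" for x c
    unfolding \<phi>_def using that by (intro cSUP_least) auto
  have tz: "0 \<le> t *\<^sub>R z" if "0 \<le> t" for t using that z by (rule scaleR_nonneg_nonneg)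
  have "\<phi> (x + y) = \<phi> x + \<phi> y" if "0 \<le> x" "0 \<le> y" for x y
  proof (rule antisym)
    show "\<phi> (x + y) \<le> \<phi> x + \<phi> y"
    proof (rule least)
      fix t :: real assume t: "0 \<le> t"
      have "inf (x + y) (t *\<^sub>R z) \<le> inf x (t *\<^sub>R z) + inf y (t *\<^sub>R z)"
        using inf_add_le[of "t *\<^sub>R z" x y] that tz[OF t] by (simp add: inf_commute)
      from mono[OF this] show "blinfun_apply f (inf (x + y) (t *\<^sub>R z)) \<le> \<phi> x + \<phi> y"
        using up[OF t, of x] up[OF t, of y] by (simp add: blinfun.add_right)
    qed
    have "\<phi> x \<le> \<phi> (x + y) - \<phi> y"
    proof (rule least)
      fix t :: real assume t: "0 \<le> t"
      have "\<phi> y \<le> \<phi> (x + y) - blinfun_apply f (inf x (t *\<^sub>R z))"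
      proof (rule least)
        fix s :: real assume s: "0 \<le> s"
        \<comment> \<open>The level \<open>t + s\<close> for \<open>x + y\<close> absorbs the
          separate levels chosen for \<open>x\<close> and \<open>y\<close>.\<close>
        have "inf x (t *\<^sub>R z) + inf y (s *\<^sub>R z) \<le> inf (x + y) ((t + s) *\<^sub>R z)"
          by (simp add: scaleR_add_left add_mono)
        from mono[OF this] show "blinfun_apply f (inf y (s *\<^sub>R z)) \<le> \<phi> (x + y) - blinfun_apply f (inf x (t *\<^sub>R z))"
          using up[of "t + s" "x + y"] t s by (simp add: blinfun.add_right)
      qed
      then show "blinfun_apply f (inf x (t *\<^sub>R z)) \<le> \<phi> (x + y) - \<phi> y" by simp
    qed
    then show "\<phi> x + \<phi> y \<le> \<phi> (x + y)" by simp
  qed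
  moreover have "0 \<le> \<phi> x" if "0 \<le> x" for x
    using up[of 0 x] that by (simp add: inf_absorb2 blinfun.zero_right)
  moreover have "\<phi> x \<le> norm f * norm x" if "0 \<le> x" for x
  proof (rule least)
    fix t :: real assume "0 \<le> t"
    have "blinfun_apply f (inf x (t *\<^sub>R z)) \<le> blinfun_apply f x" by (simp add: mono)
    also have "\<dots> \<le> norm f * norm x" using norm_blinfun[of f x] by simp
    finally show "blinfun_apply f (inf x (t *\<^sub>R z)) \<le> norm f * norm x" .
  qed
  ultimately obtain g :: "'a \<Rightarrow>\<^sub>L real" where g: "\<And>x. 0 \<le> x \<Longrightarrow> blinfun_apply g x = \<phi> x"
    using cone_extension by metis
  show ?thesis
  proof (rule that[of g])
    fix x :: 'a and e :: real assume x: "0 \<le> x" and e: "0 < e"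
    show "\<exists>t\<ge>0. blinfun_apply g x < blinfun_apply f (inf x (t *\<^sub>R z)) + e"
    proof (rule ccontr)
      assume "\<not> ?thesis"
      then have "\<phi> x \<le> \<phi> x - e" using g[OF x] by (intro least) force
      with e show False by simp
    qed
  qed (simp add: g up)
qed

text \<open>The components \<open>G n\<close> of a dominating functional \<open>g\<close> carried by
  \<open>\<bar>x n\<bar>\<close> are weak-star null, so the property applies to them and to the
  disjoint sequence \<open>\<bar>x n\<bar>\<close>. The choice \<open>t = 1\<close> bounds
  \<open>\<bar>f (x n)\<bar>\<close> by \<open>G n \<bar>x n\<bar>\<close>.\<close>

lemma disjoint_seq_functional_tendsto_0:
  fixes x :: "nat \<Rightarrow> 'a::banach_lattice" and f :: "'a \<Rightarrow>\<^sub>L real"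
  assumes DP: "disjoint_weak_star_DP TYPE('a)" and bd: "bounded (range x)" and dj: "disjoint_seq x"
  shows "(\<lambda>n. blinfun_apply f (x n)) \<longlonglongrightarrow> 0"
proof -
  obtain g :: "'a \<Rightarrow>\<^sub>L real" where dom: "\<And>x. \<bar>blinfun_apply f x\<bar> \<le> blinfun_apply g \<bar>x\<bar>"
    using functional_dominated[of f] by blast
  have pos: "0 \<le> blinfun_apply g x" if "0 \<le> x" for x using dom[of x] that by simp
  have "\<exists>h::'a \<Rightarrow>\<^sub>L real. (\<forall>a\<ge>0. \<forall>t\<ge>0. blinfun_apply g (inf a (t *\<^sub>R \<bar>x n\<bar>)) \<le> blinfun_apply h a) \<and>
      (\<forall>a\<ge>0. \<forall>e>0. \<exists>t\<ge>0. blinfun_apply h a < blinfun_apply g (inf a (t *\<^sub>R \<bar>x n\<bar>)) + e)" for n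
  proof (rule functional_component[where f = g and z = "\<bar>x n\<bar>"])
    fix h :: "'a \<Rightarrow>\<^sub>L real"
    assume "\<And>a t. 0 \<le> a \<Longrightarrow> 0 \<le> t \<Longrightarrow> blinfun_apply g (inf a (t *\<^sub>R \<bar>x n\<bar>)) \<le> blinfun_apply h a"
      "\<And>a e. 0 \<le> a \<Longrightarrow> 0 < e \<Longrightarrow> \<exists>t\<ge>0. blinfun_apply h a < blinfun_apply g (inf a (t *\<^sub>R \<bar>x n\<bar>)) + e"
    then show ?thesis by (intro exI[of _ h]) simp
  qed (auto intro: pos)
  then obtain G :: "nat \<Rightarrow> 'a \<Rightarrow>\<^sub>L real"
    where G1: "\<And>n a t. 0 \<le> a \<Longrightarrow> 0 \<le> t \<Longrightarrow> blinfun_apply g (inf a (t *\<^sub>R \<bar>x n\<bar>)) \<le> blinfun_apply (G n) a"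
      and G2: "\<And>n a e. 0 \<le> a \<Longrightarrow> 0 < e \<Longrightarrow>
                \<exists>t\<ge>0. blinfun_apply (G n) a < blinfun_apply g (inf a (t *\<^sub>R \<bar>x n\<bar>)) + e"
    by metis
  have G_lim: "(\<lambda>n. blinfun_apply (G n) a) \<longlonglongrightarrow> 0" if a: "0 \<le> a" for a
  proof -
    have "\<exists>t\<ge>0. blinfun_apply (G n) a < blinfun_apply g (inf a (t *\<^sub>R \<bar>x n\<bar>)) + 1 / real (Suc n)" for n
      using G2[OF a] by simp
    then obtain t where t: "\<And>n. 0 \<le> t n"
        "\<And>n. blinfun_apply (G n) a < blinfun_apply g (inf a (t n *\<^sub>R \<bar>x n\<bar>)) + 1 / real (Suc n)"
      by metis
    \<comment> \<open>These truncations attain \<open>G n a\<close> up to \<open>1 / Suc n\<close>.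
      They are disjoint and below \<open>a\<close>, so \<open>g\<close> tends to 0 along
      them.\<close>
    define v where "v n = inf a (t n *\<^sub>R \<bar>x n\<bar>)" for n
    have v_pos: "0 \<le> v n" for n
      using a t by (simp add: v_def scaleR_nonneg_nonneg)
    have "inf (v m) (v n) = 0" if "m \<noteq> n" for m n
    proof (rule antisym)
      have "inf (v m) (v n) \<le> inf (t m *\<^sub>R \<bar>x m\<bar>) (t n *\<^sub>R \<bar>x n\<bar>)"
        unfolding v_def by (intro inf_mono) auto
      also have "\<dots> = 0"
        using dj that t by (intro inf_scaleR_eq_0) (auto simp: disjoint_seq_def)
      finally show "inf (v m) (v n) \<le> 0" .
    qed (use v_pos in simp)
    then have "(\<Sum>i<n. v i) \<le> a" for n
      using a v_pos by (intro disjoint_sum_le) (auto simp: v_def)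
    then have "(\<lambda>n. blinfun_apply g (v n)) \<longlonglongrightarrow> 0"
      using v_pos by (intro order_bounded_sum_tendsto_0)
    then have "(\<lambda>n. blinfun_apply g (v n) + 1 / real (Suc n)) \<longlonglongrightarrow> 0"
      using tendsto_add[OF _ LIMSEQ_Suc[OF lim_inverse_n']] by fastforce
    then show ?thesis
    proof (rule tendsto_sandwich[rotated 3])
      show "\<forall>\<^sub>F n in sequentially. 0 \<le> blinfun_apply (G n) a"
        using G1[OF a t(1)] pos[OF v_pos] unfolding v_def by (intro always_eventually allI) (rule order_trans)
      show "\<forall>\<^sub>F n in sequentially. blinfun_apply (G n) a \<le> blinfun_apply g (v n) + 1 / real (Suc n)"
        using t(2) unfolding v_def by (intro always_eventually allI less_imp_le)
    qed simp
  qed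
  have "weak_star_null G"
    unfolding weak_star_null_def
  proof
    fix a :: 'a
    have "blinfun_apply (G n) a = blinfun_apply (G n) (pprt a) - blinfun_apply (G n) (pprt (- a))" for n
      using prts[of a] by (simp add: pprt_neg flip: blinfun.diff_right)
    then show "(\<lambda>n. blinfun_apply (G n) a) \<longlonglongrightarrow> 0"
      using tendsto_diff[OF G_lim[of "pprt a"] G_lim[of "pprt (- a)"]] by simp
  qed
  moreover have "bounded (range (\<lambda>n. \<bar>x n\<bar>))" "disjoint_seq (\<lambda>n. \<bar>x n\<bar>)"
    using bd dj by (simp_all add: bounded_iff disjoint_seq_def)
  ultimately have lim: "(\<lambda>n. blinfun_apply (G n) \<bar>x n\<bar>) \<longlonglongrightarrow> 0"
    using DP by (auto simp: disjoint_weak_star_DP_def)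
  have "\<bar>blinfun_apply f (x n)\<bar> \<le> blinfun_apply (G n) \<bar>x n\<bar>" for n
    using dom[of "x n"] G1[of "\<bar>x n\<bar>" 1 n] by simp
  then show ?thesis
    by (intro Lim_null_comparison[OF _ lim] always_eventually) simp
qed

section \<open>The disjoint weak-star Dunford-Pettis property and M-weak compactness\<close>

lemma DP_imp_M_weakly_compact:
  fixes T :: "'a::banach_lattice \<Rightarrow>\<^sub>L c0"
  assumes DP: "disjoint_weak_star_DP TYPE('a)"
  shows "M_weakly_compact T"
  unfolding M_weakly_compact_def
proof (intro allI impI)
  fix x :: "nat \<Rightarrow> 'a"
  assume bd: "bounded (range x)" and dj: "disjoint_seq x"
  show "(\<lambda>n. norm (blinfun_apply T (x n))) \<longlonglongrightarrow> 0"
  proof (rule LIMSEQ_I)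
    fix e :: real assume e: "0 < e"
    \<comment> \<open>A coordinate at which \<open>T (x n)\<close> is large, if its norm exceeds
      \<open>e / 2\<close>. The default \<open>n\<close> keeps \<open>\<kappa>\<close> tending to
      infinity over the other indices.\<close>
    define \<kappa> where "\<kappa> n = (if e / 2 < norm (blinfun_apply T (x n))
      then SOME m. e / 2 < \<bar>c0_nth (blinfun_apply T (x n)) m\<bar> else n)" for n
    have \<kappa>: "e / 2 < \<bar>c0_nth (blinfun_apply T (x n)) (\<kappa> n)\<bar>" if "e / 2 < norm (blinfun_apply T (x n))" for n
    proof -
      obtain m where "e / 2 < \<bar>c0_nth (blinfun_apply T (x n)) m\<bar>"
        using c0_norm_gt \<open>e / 2 < _\<close> by blast
      then show ?thesis unfolding \<kappa>_def using that by (auto intro: someI)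
    qed
    \<comment> \<open>Every fixed coordinate of \<open>T\<close> tends to 0 along \<open>x\<close>,
      so the finitely many coordinates below \<open>M\<close> are eventually too small to be
      selected.\<close>
    have "filterlim \<kappa> at_top sequentially"
      unfolding filterlim_at_top_ge[where c = 0]
    proof (intro allI impI)
      fix M :: nat
      have "\<forall>\<^sub>F n in sequentially. \<forall>m\<in>{..<M}. \<bar>c0_nth (blinfun_apply T (x n)) m\<bar> < e / 2"
      proof (rule eventually_ball_finite, simp, rule ballI)
        fix m
        have "(\<lambda>n. c0_nth (blinfun_apply T (x n)) m) \<longlonglongrightarrow> 0"
          using disjoint_seq_functional_tendsto_0[OF DP bd dj, of "coord T m"] by simp
        from LIMSEQ_D[OF this, of "e / 2"] e
        show "\<forall>\<^sub>F n in sequentially. \<bar>c0_nth (blinfun_apply T (x n)) m\<bar> < e / 2"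
          by (auto simp: eventually_sequentially)
      qed
      then show "\<forall>\<^sub>F n in sequentially. M \<le> \<kappa> n"
        using eventually_ge_at_top[of M]
      proof eventually_elim
        case (elim n)
        show ?case
        proof (cases "e / 2 < norm (blinfun_apply T (x n))")
          case True
          from \<kappa>[OF this] elim(1) show ?thesis by (meson lessThan_iff not_le order_less_asym)
        next
          case False
          then show ?thesis using elim(2) by (simp add: \<kappa>_def)
        qed
      qed
    qed
    then have "weak_star_null (\<lambda>n. coord T (\<kappa> n))"
      using weak_star_null_coord[of T] unfolding weak_star_null_def
      by (auto intro: filterlim_compose)
    then have "(\<lambda>n. blinfun_apply (coord T (\<kappa> n)) (x n)) \<longlonglongrightarrow> 0"
      using DP bd dj unfolding disjoint_weak_star_DP_def by blast
    from LIMSEQ_D[OF this, of "e / 2"] e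
    obtain N where N: "\<And>n. n \<ge> N \<Longrightarrow> \<bar>c0_nth (blinfun_apply T (x n)) (\<kappa> n)\<bar> < e / 2" by auto
    have "norm (blinfun_apply T (x n)) < e" if "n \<ge> N" for n
      using \<kappa>[of n] N[OF that] e by (cases "e / 2 < norm (blinfun_apply T (x n))") auto
    then show "\<exists>N. \<forall>n\<ge>N. norm (norm (blinfun_apply T (x n)) - 0) < e" by auto
  qed
qed

lemma M_weakly_compact_imp_DP:
  assumes M: "\<And>T :: 'a::banach_lattice \<Rightarrow>\<^sub>L c0. M_weakly_compact T"
  shows "disjoint_weak_star_DP TYPE('a)"
  unfolding disjoint_weak_star_DP_def
proof (intro allI impI)
  fix x :: "nat \<Rightarrow> 'a" and f :: "nat \<Rightarrow> 'a \<Rightarrow>\<^sub>L real"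
  assume "bounded (range x)" "disjoint_seq x" "weak_star_null f"
  moreover then obtain T where T: "coord T = f" using weak_star_null_imp_coord by blast
  ultimately have lim: "(\<lambda>n. norm (blinfun_apply T (x n))) \<longlonglongrightarrow> 0"
    using M[of T] by (auto simp: M_weakly_compact_def)
  have "norm (blinfun_apply (f n) (x n)) \<le> norm (blinfun_apply T (x n))" for n
    using c0_nth_le_norm[of "blinfun_apply T (x n)" n] by (simp flip: T)
  then show "(\<lambda>n. blinfun_apply (f n) (x n)) \<longlonglongrightarrow> 0"
    by (intro Lim_null_comparison[OF _ lim] always_eventually) simp
qed

text \<open>The truncations at \<open>u\<close> are disjoint and below \<open>u\<close>, so their
  partial sums are bounded by \<open>u\<close> and every functional tends to 0 along them.\<close>

lemma disjoint_seq_imp_uaw_null: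
  fixes x :: "nat \<Rightarrow> 'a::banach_lattice"
  assumes dj: "disjoint_seq x"
  shows "uaw_tendsto x 0"
  unfolding uaw_tendsto_def weakly_tendsto_def
proof (intro allI impI)
  fix u :: 'a and f :: "'a \<Rightarrow>\<^sub>L real" assume u: "0 \<le> u"
  define v where "v n = inf \<bar>x n - 0\<bar> u" for n
  have v_pos: "0 \<le> v n" for n using u by (simp add: v_def)
  have "inf (v m) (v n) = 0" if "m \<noteq> n" for m n
  proof (rule antisym)
    have "inf (v m) (v n) \<le> inf \<bar>x m\<bar> \<bar>x n\<bar>" unfolding v_def by (intro inf_mono) auto
    also have "\<dots> = 0" using dj that by (simp add: disjoint_seq_def)
    finally show "inf (v m) (v n) \<le> 0" .
  qed (use v_pos in simp)
  then have "(\<Sum>i<n. v i) \<le> u" for n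
    using u v_pos by (intro disjoint_sum_le) (auto simp: v_def)
  then have "(\<lambda>n. blinfun_apply f (v n)) \<longlonglongrightarrow> 0"
    using v_pos by (intro order_bounded_sum_tendsto_0)
  then show "(\<lambda>n. blinfun_apply f (inf \<bar>x n - 0\<bar> u)) \<longlonglongrightarrow> blinfun_apply f 0"
    by (simp add: v_def blinfun.zero_right)
qed

lemma uaw_Dunford_Pettis_imp_M_weakly_compact: "uaw_Dunford_Pettis T \<Longrightarrow> M_weakly_compact T"
  by (simp add: uaw_Dunford_Pettis_def M_weakly_compact_def disjoint_seq_imp_uaw_null)

section \<open>Phillips' lemma\<close>

locale order_summable =
  fixes v :: "nat \<Rightarrow> 'a::banach_lattice" and u :: 'a
  assumes sigma: "sigma_dedekind_complete TYPE('a)"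
    and v_pos: "\<And>k. 0 \<le> v k"
    and v_sum: "\<And>n. (\<Sum>k<n. v k) \<le> u"
begin

text \<open>The order sum of \<open>v\<close> over \<open>S\<close>. As a function of
  \<open>S\<close> it is a finitely additive measure on all sets of natural numbers, to which the
  argument of Phillips is applied.\<close>

definition osum :: "nat set \<Rightarrow> 'a" where
  "osum S = (SOME s. (\<forall>n. (\<Sum>k\<in>S \<inter> {..<n}. v k) \<le> s) \<and>
     (\<forall>b. (\<forall>n. (\<Sum>k\<in>S \<inter> {..<n}. v k) \<le> b) \<longrightarrow> s \<le> b))"

lemma partial_le: "(\<Sum>k\<in>S \<inter> {..<n}. v k) \<le> u"
  by (rule order_trans[OF sum_mono2 v_sum[of n]]) (auto simp: v_pos)

lemma osum_lub:
  "(\<forall>n. (\<Sum>k\<in>S \<inter> {..<n}. v k) \<le> osum S) \<and>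
     (\<forall>b. (\<forall>n. (\<Sum>k\<in>S \<inter> {..<n}. v k) \<le> b) \<longrightarrow> osum S \<le> b)"
proof -
  have "\<exists>s. (\<forall>n. (\<Sum>k\<in>S \<inter> {..<n}. v k) \<le> s) \<and>
     (\<forall>b. (\<forall>n. (\<Sum>k\<in>S \<inter> {..<n}. v k) \<le> b) \<longrightarrow> s \<le> b)"
    using sigma[unfolded sigma_dedekind_complete_def, rule_format, of "\<lambda>n. \<Sum>k\<in>S \<inter> {..<n}. v k"]
      partial_le by blast
  then show ?thesis unfolding osum_def by (rule someI_ex)
qed

lemma osum_upper: "(\<Sum>k\<in>S \<inter> {..<n}. v k) \<le> osum S"
  and osum_least: "(\<And>n. (\<Sum>k\<in>S \<inter> {..<n}. v k) \<le> b) \<Longrightarrow> osum S \<le> b"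
  using osum_lub by blast+

lemma osum_nonneg: "0 \<le> osum S"
  using osum_upper[of S 0] by simp

lemma osum_le: "osum S \<le> u"
  by (rule osum_least) (rule partial_le)

lemma osum_finite:
  assumes "finite S"
  shows "osum S = sum v S"
proof (rule antisym)
  show "osum S \<le> sum v S"
    by (rule osum_least) (auto intro!: sum_mono2 assms simp: v_pos)
  obtain n where "S \<subseteq> {..<n}" using assms finite_nat_iff_bounded by blast
  then show "sum v S \<le> osum S" using osum_upper[of S n] by (simp add: Int_absorb2)
qed

text \<open>Partial sums split exactly. For the harder inequality, partial sums over
  \<open>S\<close> and \<open>S'\<close> cut at different bounds \<open>m\<close> and
  \<open>n\<close> are compared at \<open>max m n\<close>.\<close>

lemma osum_Un:
  assumes "S \<inter> S' = {}"
  shows "osum (S \<union> S') = osum S + osum S'"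
proof -
  have split: "(\<Sum>k\<in>(S \<union> S') \<inter> {..<n}. v k) = (\<Sum>k\<in>S \<inter> {..<n}. v k) + (\<Sum>k\<in>S' \<inter> {..<n}. v k)" for n
    using assms by (subst sum.union_disjoint[symmetric]) (auto intro!: arg_cong[where f = "sum v"])
  show ?thesis
  proof (rule antisym)
    show "osum (S \<union> S') \<le> osum S + osum S'"
      by (rule osum_least) (simp add: split add_mono osum_upper)
    have mono: "(\<Sum>k\<in>A \<inter> {..<m}. v k) \<le> (\<Sum>k\<in>A \<inter> {..<n}. v k)" if "m \<le> n" for A m n
      using that by (intro sum_mono2) (auto simp: v_pos)
    have "osum S \<le> osum (S \<union> S') - osum S'"
    proof (rule osum_least)
      fix m
      have "osum S' \<le> osum (S \<union> S') - (\<Sum>k\<in>S \<inter> {..<m}. v k)"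
      proof (rule osum_least)
        fix n
        have "(\<Sum>k\<in>S \<inter> {..<m}. v k) + (\<Sum>k\<in>S' \<inter> {..<n}. v k)
            \<le> (\<Sum>k\<in>(S \<union> S') \<inter> {..<max m n}. v k)"
          unfolding split by (intro add_mono mono) auto
        also have "\<dots> \<le> osum (S \<union> S')" by (rule osum_upper)
        finally show "(\<Sum>k\<in>S' \<inter> {..<n}. v k) \<le> osum (S \<union> S') - (\<Sum>k\<in>S \<inter> {..<m}. v k)"
          by (simp add: algebra_simps)
      qed
      then show "(\<Sum>k\<in>S \<inter> {..<m}. v k) \<le> osum (S \<union> S') - osum S'"
        by (simp add: algebra_simps)
    qed
    then show "osum S + osum S' \<le> osum (S \<union> S')" by (simp add: algebra_simps)
  qed
qed

lemma osum_UN: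
  fixes n :: nat
  assumes "\<And>i j. i \<noteq> j \<Longrightarrow> Q i \<inter> Q j = {}"
  shows "osum (\<Union>i<n. Q i) = (\<Sum>i<n. osum (Q i))"
proof (induction n)
  case (Suc n)
  have "Q i \<inter> Q n = {}" if "i < n" for i using assms[of i n] that by simp
  then have "(\<Union>i<n. Q i) \<inter> Q n = {}" by blast
  then have "osum ((\<Union>i<n. Q i) \<union> Q n) = osum (\<Union>i<n. Q i) + osum (Q n)" by (rule osum_Un)
  with Suc show ?case by (simp add: lessThan_Suc Un_commute)
qed (simp add: osum_finite)

text \<open>Of infinitely many disjoint infinite parts of \<open>S\<close>, all but finitely many are good.\<close>

lemma small_subset:
  fixes f :: "'a \<Rightarrow>\<^sub>L real"
  assumes S: "infinite S" and d: "0 < d"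
  obtains S' where "S' \<subseteq> S" "infinite S'" "\<And>R. R \<subseteq> S' \<Longrightarrow> \<bar>blinfun_apply f (osum R)\<bar> \<le> d"
proof (rule ccontr)
  note goal = that
  assume "\<not> thesis"
  then have bad: "\<exists>R\<subseteq>S'. d < \<bar>blinfun_apply f (osum R)\<bar>" if "S' \<subseteq> S" "infinite S'" for S'
    using goal[OF that] by (meson not_le)
  \<comment> \<open>Pairing splits an enumeration of \<open>S\<close> into infinitely many disjoint
    infinite rows; each row would contain a bad subset \<open>Q i\<close>.\<close>
  define P where "P i = enumerate S ` range (\<lambda>j. prod_encode (i, j))" for i
  have inj: "inj (enumerate S)" using bij_enumerate[OF S] by (simp add: bij_betw_def)
  have P_sub: "P i \<subseteq> S" for i using enumerate_in_set[OF S] by (auto simp: P_def)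
  have P_inf: "infinite (P i)" for i
  proof -
    have "inj (\<lambda>j. enumerate S (prod_encode (i, j)))"
      by (intro injI) (simp add: inj_eq[OF inj])
    then show ?thesis unfolding P_def image_image by (rule range_inj_infinite)
  qed
  have "\<exists>R\<subseteq>P i. d < \<bar>blinfun_apply f (osum R)\<bar>" for i
    by (rule bad[OF P_sub P_inf])
  then obtain Q where Q: "\<And>i. Q i \<subseteq> P i" "\<And>i. d < \<bar>blinfun_apply f (osum (Q i))\<bar>" by metis
  have "P i \<inter> P j = {}" if "i \<noteq> j" for i j
    using that by (auto simp: P_def inj_eq[OF inj])
  then have "Q i \<inter> Q j = {}" if "i \<noteq> j" for i j using Q(1) that by blast
  \<comment> \<open>Finite additivity turns these sums into order sums over unions, which stay below
    \<open>u\<close>. Hence \<open>f\<close> tends to 0 along \<open>osum (Q i)\<close>, against the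
    choice of \<open>Q i\<close>.\<close>
  then have "(\<Sum>i<n. osum (Q i)) \<le> u" for n
    using osum_le by (metis osum_UN)
  then have "(\<lambda>i. blinfun_apply f (osum (Q i))) \<longlonglongrightarrow> 0"
    by (intro order_bounded_sum_tendsto_0 osum_nonneg)
  from LIMSEQ_D[OF this d] Q(2) show False by (auto simp: not_less dest: less_imp_le) (meson less_asym order_refl)
qed

text \<open>Gliding hump: coordinate \<open>m n\<close> of \<open>T\<close> exceeds \<open>e\<close>
  in modulus at \<open>v (k n)\<close>, but is at most \<open>e / 4\<close> on the sum of the
  earlier choices and on the order sum of the later ones. So the coordinates \<open>m n\<close> of
  \<open>T (osum (range k))\<close> stay above \<open>e / 2\<close>, although that element lies in
  the null sequences.\<close>

lemma phillips:
  fixes T :: "'a \<Rightarrow>\<^sub>L c0"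
  shows "(\<lambda>k. blinfun_apply T (v k)) \<longlonglongrightarrow> 0"
proof (rule ccontr)
  let ?f = "\<lambda>m x. c0_nth (blinfun_apply T x) m"
  assume "\<not> ?thesis"
  then obtain e where e: "0 < e" and often: "\<And>N. \<exists>k\<ge>N. 2 * e \<le> norm (blinfun_apply T (v k))"
    unfolding LIMSEQ_iff by (metis diff_zero field_sum_of_halves half_gt_zero mult_2 not_le)
  define K where "K = {k. e < norm (blinfun_apply T (v k))}"
  have K: "infinite K"
    unfolding infinite_nat_iff_unbounded_le
  proof
    fix N
    obtain k where "k \<ge> N" "2 * e \<le> norm (blinfun_apply T (v k))" using often by blast
    then show "\<exists>k\<ge>N. k \<in> K" using e by (auto simp: K_def)
  qed
  \<comment> \<open>In a state, \<open>S\<close> holds the indices still available, \<open>w\<close>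
    is the sum of the chosen elements, and \<open>m\<close>, \<open>k\<close> are the latest
    coordinate and index.\<close>
  define step where "step = (\<lambda>(S, w, m, k :: nat) (S', w', m', k').
    k' \<in> S \<and> m < m' \<and> \<bar>?f m' w\<bar> \<le> e / 4 \<and> e < \<bar>?f m' (v k')\<bar> \<and> S' \<subseteq> S \<inter> {k'<..} \<and>
    (\<forall>R\<subseteq>S'. \<bar>?f m' (osum R)\<bar> \<le> e / 4) \<and> w' = w + v k')"
  have step: "\<exists>S' w' m' k'. infinite S' \<and> S' \<subseteq> K \<and> step (S, w, m, k) (S', w', m', k')"
    if S: "infinite S" "S \<subseteq> K" for S w m k
  proof -
    obtain M0 where M0: "\<And>i. i \<ge> M0 \<Longrightarrow> \<bar>?f i w\<bar> < e / 4"
      using LIMSEQ_D[OF c0_nth_tendsto[of "blinfun_apply T w"], of "e / 4"] e by auto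
    \<comment> \<open>From \<open>M0\<close> on the coordinates of \<open>T w\<close> are small, and
      \<open>Suc m\<close> forces progress. For late \<open>k\<close> the coordinates of
      \<open>T (v k)\<close> below \<open>M\<close> are less than \<open>e\<close>, so a large
      coordinate has index at least \<open>M\<close>.\<close>
    define M where "M = max M0 (Suc m)"
    have "\<forall>\<^sub>F k in sequentially. \<forall>i\<in>{..<M}. \<bar>?f i (v k)\<bar> < e"
    proof (rule eventually_ball_finite, simp, rule ballI)
      fix i
      have "(\<lambda>k. ?f i (v k)) \<longlonglongrightarrow> 0"
        using order_bounded_sum_tendsto_0[OF v_pos v_sum, of "coord T i"] by simp
      from LIMSEQ_D[OF this e]
      show "\<forall>\<^sub>F k in sequentially. \<bar>?f i (v k)\<bar> < e" by (auto simp: eventually_sequentially)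
    qed
    then obtain N where N: "\<And>k i. k \<ge> N \<Longrightarrow> i < M \<Longrightarrow> \<bar>?f i (v k)\<bar> < e"
      by (auto simp: eventually_sequentially)
    obtain k' where k': "k' \<in> S" "k' \<ge> N"
      using S(1) unfolding infinite_nat_iff_unbounded_le by blast
    then have "e < norm (blinfun_apply T (v k'))" using S(2) by (auto simp: K_def)
    then obtain m' where m': "e < \<bar>?f m' (v k')\<bar>" by (rule c0_norm_gt)
    with N[OF k'(2), of m'] have "M \<le> m'" by (meson not_le order_less_asym)
    have "S \<inter> {k'<..} = S - {..k'}" by auto
    then have "infinite (S \<inter> {k'<..})" using S(1) by simp
    then obtain S' where "S' \<subseteq> S \<inter> {k'<..}" "infinite S'" "\<And>R. R \<subseteq> S' \<Longrightarrow> \<bar>?f m' (osum R)\<bar> \<le> e / 4"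
      using small_subset[of "S \<inter> {k'<..}" "e / 4" "coord T m'"] e by auto
    then show ?thesis
      using S(2) k'(1) m' \<open>M \<le> m'\<close> M0[of m']
      by (intro exI[of _ S'] exI[of _ "w + v k'"] exI[of _ m'] exI[of _ k'])
        (auto simp: step_def M_def)
  qed
  define P where "P = (\<lambda>(j::nat) (S, w :: 'a, m :: nat, k :: nat). infinite S \<and> S \<subseteq> K \<and> (j = 0 \<longrightarrow> w = 0))"
  have "\<exists>g. \<forall>n. P n (g n) \<and> step (g n) (g (Suc n))"
  proof (rule dependent_nat_choice)
    show "\<exists>x. P 0 x" using K by (intro exI[of _ "(K, 0, 0, 0)"]) (simp add: P_def)
    fix x n assume "P n x"
    moreover obtain S w m k where x: "x = (S, w, m, k)" by (cases x)
    ultimately obtain S' w' m' k' where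
      "infinite S'" "S' \<subseteq> K" "step (S, w, m, k) (S', w', m', k')"
      using step[of S w m k] unfolding P_def by auto
    then show "\<exists>y. P (Suc n) y \<and> step x y"
      unfolding x by (intro exI[of _ "(S', w', m', k')"]) (simp add: P_def)
  qed
  then obtain g where g: "\<And>n. P n (g n)" "\<And>n. step (g n) (g (Suc n))" by blast
  define S where "S n = fst (g n)" for n
  define w where "w n = fst (snd (g n))" for n
  \<comment> \<open>The choices \<open>m n\<close> and \<open>k n\<close> made in step
    \<open>n\<close> are stored in state \<open>Suc n\<close>, whereas \<open>S n\<close> and
    \<open>w n\<close> describe the state before that step.\<close>
  define m where "m n = fst (snd (snd (g (Suc n))))" for n
  define k where "k n = snd (snd (snd (g (Suc n))))" for n
  have k_in: "k n \<in> S n" and m_w: "\<bar>?f (m n) (w n)\<bar> \<le> e / 4" and m_v: "e < \<bar>?f (m n) (v (k n))\<bar>"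
    and S_Suc: "S (Suc n) \<subseteq> S n \<inter> {k n<..}"
    and m_tail: "\<And>R. R \<subseteq> S (Suc n) \<Longrightarrow> \<bar>?f (m n) (osum R)\<bar> \<le> e / 4"
    and w_Suc: "w (Suc n) = w n + v (k n)" for n
    using g(2)[of n] by (auto simp: step_def S_def w_def m_def k_def split: prod.splits)
  have m_Suc: "m n < m (Suc n)" for n
    using g(2)[of "Suc n"] by (auto simp: step_def m_def split: prod.splits)
  have w_0: "w 0 = 0" using g(1)[of 0] by (auto simp: P_def w_def split: prod.splits)
  have S_mono: "S j \<subseteq> S i" if "i \<le> j" for i j
    using that by (rule lift_Suc_antimono_le[rotated]) (use S_Suc in blast)
  have k_later: "k j \<in> S (Suc i)" if "i < j" for i j
    using S_mono[of "Suc i" j] k_in[of j] that by auto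
  then have k_less: "k i < k j" if "i < j" for i j
    using S_Suc[of i] that by blast
  then have "inj k" by (metis injI less_irrefl linorder_neqE_nat)
  have w_eq: "w n = osum (k ` {..<n})" for n
  proof -
    have "w n = (\<Sum>i<n. v (k i))"
      by (induction n) (simp_all add: w_0 w_Suc)
    also have "\<dots> = sum v (k ` {..<n})"
      using \<open>inj k\<close> by (subst sum.reindex) (auto intro: inj_on_subset)
    finally show ?thesis by (simp add: osum_finite)
  qed
  have big: "e / 2 < \<bar>?f (m n) (osum (range k))\<bar>" for n
  proof -
    have "range k = (k ` {..<n} \<union> {k n}) \<union> k ` {n<..}"
      by (auto simp: image_iff) (metis greaterThan_iff lessThan_iff linorder_neqE_nat)
    moreover have "(k ` {..<n} \<union> {k n}) \<inter> k ` {n<..} = {}" "k ` {..<n} \<inter> {k n} = {}"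
      using \<open>inj k\<close> by (auto simp: inj_eq)
    ultimately have "osum (range k) = w n + v (k n) + osum (k ` {n<..})"
      by (simp only: osum_Un w_eq) (simp add: osum_finite)
    then have "?f (m n) (osum (range k))
        = ?f (m n) (w n) + ?f (m n) (v (k n)) + ?f (m n) (osum (k ` {n<..}))"
      by (simp add: blinfun.add_right)
    moreover have "\<bar>?f (m n) (osum (k ` {n<..}))\<bar> \<le> e / 4"
      by (rule m_tail) (use k_later in auto)
    ultimately show ?thesis using m_w[of n] m_v[of n] by linarith
  qed
  have "strict_mono m" using m_Suc by (simp add: strict_mono_Suc_iff)
  then have "(\<lambda>n. ?f (m n) (osum (range k))) \<longlonglongrightarrow> 0"
    using LIMSEQ_subseq_LIMSEQ[OF c0_nth_tendsto] by (auto simp: o_def)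
  from LIMSEQ_D[OF this, of "e / 2"] e big show False
    by (auto simp: not_less) (meson less_asym order_refl)
qed

end

section \<open>Order bounded weakly null sequences\<close>

text \<open>For a functional \<open>T\<close> this is a substitute for the modulus, equivalent up to a factor 2.\<close>

definition osn :: "('a::banach_lattice \<Rightarrow>\<^sub>L 'b::real_normed_vector) \<Rightarrow> 'a \<Rightarrow> real" where
  "osn T v = (SUP x\<in>{0..v}. norm (blinfun_apply T x))"

lemma osn_upper:
  assumes "0 \<le> x" "x \<le> v"
  shows "norm (blinfun_apply T x) \<le> osn T v"
  unfolding osn_def
proof (rule cSUP_upper)
  show "bdd_above ((\<lambda>x. norm (blinfun_apply T x)) ` {0..v})"
  proof (rule bdd_aboveI2)
    fix y assume "y \<in> {0..v}"
    then have "norm T * norm y \<le> norm T * norm v"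
      by (intro mult_left_mono norm_mono_pos) auto
    then show "norm (blinfun_apply T y) \<le> norm T * norm v"
      using norm_blinfun[of T y] by linarith
  qed
qed (use assms in simp)

lemma osn_least:
  assumes "0 \<le> v" "\<And>x. 0 \<le> x \<Longrightarrow> x \<le> v \<Longrightarrow> norm (blinfun_apply T x) \<le> c"
  shows "osn T v \<le> c"
  unfolding osn_def using assms by (intro cSUP_least) auto

lemma osn_mono: "0 \<le> v \<Longrightarrow> v \<le> w \<Longrightarrow> osn T v \<le> osn T w"
  by (rule osn_least) (auto intro: osn_upper)

lemma osn_add:
  assumes "0 \<le> v" "0 \<le> w"
  shows "osn T (v + w) \<le> osn T v + osn T w"
proof (rule osn_least)
  fix x assume "0 \<le> x" "x \<le> v + w"
  then obtain a b where "x = a + b" "0 \<le> a" "a \<le> v" "0 \<le> b" "b \<le> w"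
    using riesz_split assms by blast
  then show "norm (blinfun_apply T x) \<le> osn T v + osn T w"
    using osn_upper[of a v T] osn_upper[of b w T] norm_triangle_ineq[of "blinfun_apply T a" "blinfun_apply T b"]
    by (simp add: blinfun.add_right)
qed (use assms in simp)

lemma osn_0: "osn T 0 = 0"
  by (simp add: osn_def blinfun.zero_right)

lemma osn_sum:
  fixes v :: "nat \<Rightarrow> 'a::banach_lattice"
  assumes "\<And>i. 0 \<le> v i"
  shows "osn T (\<Sum>i<n. v i) \<le> (\<Sum>i<n. osn T (v i))"
proof (induction n)
  case (Suc n)
  then show ?case
    using osn_add[of "\<Sum>i<n. v i" "v n" T] assms by (simp add: sum_nonneg)
qed (simp add: osn_0)

text \<open>A functional \<open>g\<close> dominating \<open>f\<close> is monotone, so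
  \<open>f\<close> is bounded by \<open>g (y n)\<close> on the order interval from 0 to
  \<open>y n\<close>.\<close>

lemma osn_functional_tendsto_0:
  fixes f :: "'a::banach_lattice \<Rightarrow>\<^sub>L real"
  assumes y: "weakly_tendsto y 0" and pos: "\<And>n. 0 \<le> y n"
  shows "(\<lambda>n. osn f (y n)) \<longlonglongrightarrow> 0"
proof -
  obtain g :: "'a \<Rightarrow>\<^sub>L real" where g: "\<And>x. \<bar>blinfun_apply f x\<bar> \<le> blinfun_apply g \<bar>x\<bar>"
    using functional_dominated[of f] by blast
  have "osn f (y n) \<le> blinfun_apply g (y n)" for n
  proof (rule osn_least)
    fix x assume x: "0 \<le> x" "x \<le> y n"
    have "0 \<le> blinfun_apply g (y n - x)"
      using g[of "y n - x"] x by simp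
    with g[of x] x show "norm (blinfun_apply f x) \<le> blinfun_apply g (y n)"
      by (simp add: blinfun.diff_right)
  qed (rule pos)
  moreover have "0 \<le> osn f (y n)" for n
    using osn_upper[of 0 "y n" f] pos by (simp add: blinfun.zero_right)
  moreover have "(\<lambda>n. blinfun_apply g (y n)) \<longlonglongrightarrow> 0"
    using y by (simp add: weakly_tendsto_def blinfun.zero_right)
  ultimately show ?thesis
    by (intro tendsto_sandwich[of "\<lambda>_. 0" "\<lambda>n. osn f (y n)" _ "\<lambda>n. blinfun_apply g (y n)"] always_eventually) auto
qed

text \<open>Otherwise infinitely many successive increments dominate elements \<open>x n\<close>
  with \<open>T (x n)\<close> of norm above \<open>e\<close>. The increments telescope, so the
  partial sums of \<open>x\<close> stay below \<open>u\<close>, which contradicts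
  \<open>phillips\<close>.\<close>

lemma increasing_osn_Cauchy:
  fixes a :: "nat \<Rightarrow> 'a::banach_lattice" and T :: "'a \<Rightarrow>\<^sub>L c0"
  assumes sigma: "sigma_dedekind_complete TYPE('a)"
    and pos: "\<And>n. 0 \<le> a n" and le: "\<And>n. a n \<le> u" and inc: "incseq a" and e: "0 < e"
  shows "\<exists>N. \<forall>n\<ge>N. osn T (a n - a N) \<le> e"
proof (rule ccontr)
  assume "\<not> ?thesis"
  then have bad: "\<exists>n\<ge>N. e < osn T (a n - a N)" for N
    by (meson not_le)
  \<comment> \<open>The conjunct \<open>True\<close> is a trivial invariant that matches the form of
    \<open>dependent_nat_choice\<close>.\<close>
  have "\<exists>r. \<forall>n. True \<and> (r n \<le> r (Suc n) \<and> e < osn T (a (r (Suc n)) - a (r n)))"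
    by (rule dependent_nat_choice) (use bad in auto)
  then obtain r where r: "\<And>n. r n \<le> r (Suc n)" "\<And>n. e < osn T (a (r (Suc n)) - a (r n))"
    by blast
  have "\<exists>x. 0 \<le> x \<and> x \<le> a (r (Suc n)) - a (r n) \<and> e < norm (blinfun_apply T x)" for n
  proof (rule ccontr)
    assume "\<not> ?thesis"
    then have "osn T (a (r (Suc n)) - a (r n)) \<le> e"
      using inc r(1) by (intro osn_least) (auto simp: incseq_def not_less)
    with r(2)[of n] show False by simp
  qed
  then obtain x where x: "\<And>n. 0 \<le> x n" "\<And>n. x n \<le> a (r (Suc n)) - a (r n)"
      "\<And>n. e < norm (blinfun_apply T (x n))" by metis
  have "(\<Sum>i<n. x i) \<le> u" for n
  proof -
    have "(\<Sum>i<n. x i) \<le> (\<Sum>i<n. a (r (Suc i)) - a (r i))" by (intro sum_mono x)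
    also have "\<dots> = a (r n) - a (r 0)" by (rule sum_lessThan_telescope)
    also have "\<dots> \<le> u - 0" by (intro diff_mono le pos)
    finally show ?thesis by simp
  qed
  then interpret order_summable x u by unfold_locales (use sigma x in auto)
  from LIMSEQ_D[OF phillips[of T] e] x(3) show False
    by (auto simp: not_less) (meson less_asym order_refl)
qed

section \<open>A Vitali-Hahn-Saks argument in the lattice\<close>

fun sup_from :: "(nat \<Rightarrow> 'a::semilattice_sup) \<Rightarrow> nat \<Rightarrow> nat \<Rightarrow> 'a" where
  "sup_from z k 0 = z k"
| "sup_from z k (Suc i) = sup (sup_from z k i) (z (k + Suc i))"

lemma sup_from_ge: "z (k + i) \<le> sup_from z k i"
  by (cases i) auto

lemma incseq_sup_from: "incseq (sup_from z k)"
  by (rule incseq_SucI) simp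

lemma sup_from_le: "(\<And>n. z n \<le> u) \<Longrightarrow> sup_from z k i \<le> u"
  by (induction i) auto

lemma sup_from_nonneg: "(\<And>n. 0 \<le> z n) \<Longrightarrow> 0 \<le> sup_from z k i"
  for z :: "nat \<Rightarrow> 'a::lattice_ab_group_add"
  by (rule order_trans[OF _ sup_from_ge])

lemma sup_from_le_sum:
  fixes z :: "nat \<Rightarrow> 'a::lattice_ab_group_add"
  assumes "\<And>n. 0 \<le> z n"
  shows "sup_from z k i \<le> (\<Sum>j<Suc i. z (k + j))"
proof (induction i)
  case (Suc i)
  have "0 \<le> (\<Sum>j<Suc i. z (k + j))" by (intro sum_nonneg assms)
  then show ?case
    using Suc assms[of "k + Suc i"] unfolding sum.lessThan_Suc[of _ "Suc i"] sup_from.simps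
    by (intro sup_least) (auto intro: add_increasing2 add_increasing)
qed simp

text \<open>The elements \<open>D k\<close> play the role of the unions \<open>\<Union>j\<ge>k. A j\<close> of sets in
  the measure-theoretic argument; each infinite union is replaced by a finite one up to a small
  error.\<close>

lemma order_bounded_aux:
  fixes z :: "nat \<Rightarrow> 'a::banach_lattice" and T :: "'a \<Rightarrow>\<^sub>L c0"
  assumes sigma: "sigma_dedekind_complete TYPE('a)"
    and pos: "\<And>n. 0 \<le> z n" and le: "\<And>n. z n \<le> u" and e: "0 < e"
    and big: "\<And>n. e < norm (blinfun_apply T (z n))"
    and small: "\<And>m n. m \<le> n \<Longrightarrow> osn (coord T m) (z n) \<le> (1/2) ^ n"
  shows False
proof -
  define C where "C = sup_from z"
  have C_pos: "0 \<le> C k i" and C_le: "C k i \<le> u" for k i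
    unfolding C_def by (rule sup_from_nonneg, rule pos, rule sup_from_le, rule le)
  have C_inc: "incseq (C k)" for k unfolding C_def by (rule incseq_sup_from)
  \<comment> \<open>A finite supremum is below the sum, and the bounds in \<open>small\<close> add
    up to a geometric series.\<close>
  have C_osn: "osn (coord T m) (C k i) \<le> 2 * (1/2) ^ k" if "m \<le> k" for m k i
  proof -
    have "osn (coord T m) (C k i) \<le> osn (coord T m) (\<Sum>j<Suc i. z (k + j))"
      using C_pos sup_from_le_sum[of z k i] pos by (intro osn_mono) (auto simp: C_def)
    also have "\<dots> \<le> (\<Sum>j<Suc i. osn (coord T m) (z (k + j)))"
      by (intro osn_sum pos)
    also have "\<dots> \<le> (\<Sum>j<Suc i. (1/2) ^ k * (1/2) ^ j)"
      using that by (intro sum_mono) (auto simp flip: power_add intro!: small)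
    also have "\<dots> = (1/2) ^ k * (2 - 2 * (1/2) ^ Suc i)"
      by (simp add: sum_gp_strict flip: sum_distrib_left)
    also have "\<dots> \<le> (1/2) ^ k * 2" by (intro mult_left_mono) auto
    finally show ?thesis by simp
  qed
  \<comment> \<open>The tolerances are summable in \<open>k\<close>: replacing every supremum by a
    finite one costs at most \<open>e / 2\<close> in total.\<close>
  have "\<exists>N. \<forall>n\<ge>N. osn T (C k n - C k N) \<le> e / 4 * (1/2) ^ k" for k
    by (rule increasing_osn_Cauchy[OF sigma C_pos C_le C_inc]) (use e in simp)
  then obtain N where N: "\<And>k n. n \<ge> N k \<Longrightarrow> osn T (C k n - C k (N k)) \<le> e / 4 * (1/2) ^ k"
    by metis
  define E where "E k = C k (N k)" for k
  \<comment> \<open>Decreasing meets of the finite suprema \<open>E k\<close>, a finite-stage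
    version of the upper limit of the \<open>z n\<close>.\<close>
  define D where "D = rec_nat (E 0) (\<lambda>k d. inf d (E (Suc k)))"
  have D_0: "D 0 = E 0" and D_Suc: "D (Suc k) = inf (D k) (E (Suc k))" for k
    by (simp_all add: D_def)
  have D_pos: "0 \<le> D k" for k by (induction k) (simp_all add: D_0 D_Suc E_def C_pos)
  have D_le: "D k \<le> E k" for k by (cases k) (simp_all add: D_0 D_Suc)
  have D_dec: "decseq D" by (rule decseq_SucI) (simp add: D_Suc)
  have D_u: "D k \<le> u" for k using D_le[of k] C_le[of k "N k"] by (simp add: E_def)
  have one: "osn T (z n - inf (z n) (E k)) \<le> e / 4 * (1/2) ^ k" if "n \<ge> k + N k" for n k
  proof (rule order_trans[OF osn_mono N])
    show "n - k \<ge> N k" using that by simp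
    have "z n \<le> C k (n - k)" using sup_from_ge[of z k "n - k"] that by (simp add: C_def)
    moreover have "E k \<le> C k (n - k)" using C_inc[of k] that by (auto simp: E_def incseq_def)
    ultimately show "z n - inf (z n) (E k) \<le> C k (n - k) - C k (N k)"
      unfolding diff_inf_eq_pos by (simp add: E_def)
    show "0 \<le> z n - inf (z n) (E k)" unfolding diff_inf_eq_pos by simp
  qed
  \<comment> \<open>Cutting \<open>z n\<close> down to \<open>D (Suc k)\<close> removes at most what
    the cuts to \<open>D k\<close> and to \<open>E (Suc k)\<close> remove together, so the errors
    add up.\<close>
  have all: "\<forall>\<^sub>F n in sequentially. osn T (z n - inf (z n) (D k)) \<le> e / 4 * (\<Sum>j<Suc k. (1/2) ^ j)" for k
  proof (induction k)
    case 0
    show ?case using one[of 0] by (auto simp: eventually_sequentially D_0 simp del: diff_inf_eq_sup)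
  next
    case (Suc k)
    show ?case using Suc eventually_ge_at_top[of "Suc k + N (Suc k)"]
    proof eventually_elim
      case (elim n)
      define a where "a = z n - inf (z n) (D k)"
      define b where "b = z n - inf (z n) (E (Suc k))"
      have ab: "0 \<le> a" "0 \<le> b" unfolding a_def b_def diff_inf_eq_pos by simp_all
      have "z n - (a + b) \<le> inf (z n - a) (z n - b)" using ab by (simp add: le_inf_iff)
      also have "\<dots> = inf (z n) (D (Suc k))"
        by (simp add: a_def b_def D_Suc inf_aci del: diff_inf_eq_sup)
      finally have "z n - inf (z n) (D (Suc k)) \<le> a + b" by (simp only: diff_le_eq add.commute)
      then have "osn T (z n - inf (z n) (D (Suc k))) \<le> osn T (a + b)"
        by (intro osn_mono) (simp_all only: diff_inf_eq_pos sup_ge2)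
      also have "\<dots> \<le> osn T a + osn T b" by (rule osn_add[OF ab])
      also have "\<dots> \<le> e / 4 * (\<Sum>j<Suc k. (1/2) ^ j) + e / 4 * (1/2) ^ Suc k"
        using elim(1) one[OF elim(2)] by (intro add_mono) (simp_all only: a_def b_def)
      finally show ?case by (simp add: distrib_left)
    qed
  qed
  \<comment> \<open>Truncating a late \<open>z n\<close> at \<open>D k\<close> changes its image by
    at most \<open>e / 2\<close>, so the truncated part, which lies below \<open>D k\<close>, keeps
    an image of norm at least \<open>e / 2\<close>.\<close>
  have D_big: "e / 2 \<le> osn T (D k)" for k
  proof -
    obtain n where n: "osn T (z n - inf (z n) (D k)) \<le> e / 4 * (\<Sum>j<Suc k. (1/2) ^ j)"
      using all[of k] by (auto simp: eventually_sequentially)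
    have "(\<Sum>j<Suc k. (1/2) ^ j) \<le> (2::real)" by (simp add: sum_gp_strict)
    then have "e / 4 * (\<Sum>j<Suc k. (1/2) ^ j) \<le> e / 4 * 2"
      using e by (intro mult_left_mono) auto
    with n have *: "osn T (z n - inf (z n) (D k)) \<le> e / 2" by linarith
    have "norm (blinfun_apply T (z n - inf (z n) (D k))) \<le> osn T (z n - inf (z n) (D k))"
      by (intro osn_upper) (simp_all only: diff_inf_eq_pos sup_ge2 order_refl)
    moreover have "norm (blinfun_apply T (inf (z n) (D k))) \<le> osn T (D k)"
      using pos D_pos by (intro osn_upper) auto
    moreover have "norm (blinfun_apply T (z n)) \<le> norm (blinfun_apply T (inf (z n) (D k)))
        + norm (blinfun_apply T (z n - inf (z n) (D k)))"
      unfolding blinfun.diff_right by (rule norm_triangle_sub)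
    ultimately show ?thesis using big[of n] * by linarith
  qed
  \<comment> \<open>Reflecting the decreasing sequence \<open>D\<close> in \<open>u\<close> makes
    the Cauchy property of increasing sequences available.\<close>
  have "incseq (\<lambda>k. u - D k)" using D_dec by (auto simp: incseq_def decseq_def intro: diff_left_mono)
  then obtain k0 where k0: "\<And>k. k \<ge> k0 \<Longrightarrow> osn T ((u - D k) - (u - D k0)) \<le> e / 4"
    using increasing_osn_Cauchy[OF sigma, of "\<lambda>k. u - D k" u "e / 4" T] D_pos D_u e by fastforce
  have "osn T (D k0) \<le> e / 4"
  proof (rule osn_least)
    fix x assume x: "0 \<le> x" "x \<le> D k0"
    show "norm (blinfun_apply T x) \<le> e / 4"
    proof (rule norm_c0_leI)
      fix m
      \<comment> \<open>Coordinate \<open>m\<close> is small on \<open>inf x (D k)\<close> because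
        that lies below \<open>E k\<close>, and at most \<open>e / 4\<close> on the rest because
        that lies below \<open>D k0 - D k\<close>. Then \<open>k\<close> tends to infinity.\<close>
      have "\<bar>c0_nth (blinfun_apply T x) m\<bar> \<le> 2 * (1/2) ^ k + e / 4" if k: "k \<ge> max m k0" for k
      proof -
        define y where "y = x - inf x (D k)"
        have y: "0 \<le> y" "y \<le> D k0 - D k"
          using x D_dec k unfolding y_def diff_inf_eq_pos by (auto simp: decseq_def)
        have "\<bar>c0_nth (blinfun_apply T (inf x (D k))) m\<bar> \<le> osn (coord T m) (E k)"
          using osn_upper[of "inf x (D k)" "E k" "coord T m"] x D_pos[of k] D_le[of k]
          by (simp add: le_infI2)
        also have "\<dots> \<le> 2 * (1/2) ^ k" using k C_osn by (simp add: E_def)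
        finally have 1: "\<bar>c0_nth (blinfun_apply T (inf x (D k))) m\<bar> \<le> 2 * (1/2) ^ k" .
        have "\<bar>c0_nth (blinfun_apply T y) m\<bar> \<le> norm (blinfun_apply T y)" by (rule c0_nth_le_norm)
        also have "\<dots> \<le> e / 4" using osn_upper[OF y, of T] k0[of k] k by (simp add: algebra_simps)
        finally have 2: "\<bar>c0_nth (blinfun_apply T y) m\<bar> \<le> e / 4" .
        have "blinfun_apply T x = blinfun_apply T (inf x (D k)) + blinfun_apply T y"
          unfolding y_def blinfun.diff_right by simp
        with 1 2 show ?thesis by simp
      qed
      moreover have "(\<lambda>k. 2 * (1/2) ^ k + e / 4) \<longlonglongrightarrow> 2 * 0 + e / 4"
        by (intro tendsto_intros LIMSEQ_power_zero) simp
      ultimately show "\<bar>c0_nth (blinfun_apply T x) m\<bar> \<le> e / 4"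
        by (intro tendsto_lowerbound[where F = sequentially])
          (auto simp: eventually_sequentially intro!: exI[of _ "max m k0"])
    qed
  qed (rule D_pos)
  with D_big[of k0] e show False by simp
qed

text \<open>If the images do not tend to 0, a selection of indices keeps their norms above
  \<open>e\<close> while more and more coordinates become geometrically small in the sense of
  \<open>osn\<close>. This is the situation excluded by \<open>order_bounded_aux\<close>.\<close>

lemma order_bounded_weakly_null:
  fixes y :: "nat \<Rightarrow> 'a::banach_lattice" and T :: "'a \<Rightarrow>\<^sub>L c0"
  assumes sigma: "sigma_dedekind_complete TYPE('a)"
    and y: "weakly_tendsto y 0" and pos: "\<And>n. 0 \<le> y n" and le: "\<And>n. y n \<le> u"
  shows "(\<lambda>n. blinfun_apply T (y n)) \<longlonglongrightarrow> 0"
proof (rule ccontr)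
  assume "\<not> ?thesis"
  then obtain e where e: "0 < e" and often: "\<And>N. \<exists>k\<ge>N. 2 * e \<le> norm (blinfun_apply T (y k))"
    unfolding LIMSEQ_iff by (metis diff_zero field_sum_of_halves half_gt_zero mult_2 not_le)
  have "\<exists>k. e < norm (blinfun_apply T (y k)) \<and> (\<forall>m\<le>n. osn (coord T m) (y k) \<le> (1/2) ^ n)" for n
  proof -
    have "\<forall>\<^sub>F k in sequentially. \<forall>m\<in>{..n}. osn (coord T m) (y k) < (1/2) ^ n"
    proof (rule eventually_ball_finite, simp, rule ballI)
      fix m
      from osn_functional_tendsto_0[OF y pos, of "coord T m"]
      show "\<forall>\<^sub>F k in sequentially. osn (coord T m) (y k) < (1/2) ^ n"
        by (rule order_tendstoD) simp
    qed
    then obtain M where M: "\<And>k m. k \<ge> M \<Longrightarrow> m \<le> n \<Longrightarrow> osn (coord T m) (y k) < (1/2) ^ n"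
      by (auto simp: eventually_sequentially)
    obtain k where "k \<ge> M" "2 * e \<le> norm (blinfun_apply T (y k))" using often by blast
    with M e show ?thesis by (intro exI[of _ k]) (auto intro: less_imp_le)
  qed
  then obtain r where "\<And>n. e < norm (blinfun_apply T (y (r n)))"
      "\<And>m n. m \<le> n \<Longrightarrow> osn (coord T m) (y (r n)) \<le> (1/2) ^ n"
    by metis
  then show False
    using order_bounded_aux[OF sigma, of "\<lambda>n. y (r n)" u e T] pos le e by simp
qed

section \<open>M-weakly compact operators\<close>

text \<open>Subtracting the infimum from \<open>pprt w\<close> leaves the positive part of
  \<open>pprt w - pprt (- w) = w\<close>, which is \<open>pprt w\<close> again.\<close>

lemma pprt_disjoint: "inf (pprt w) (pprt (- w)) = 0" for w :: "'a::lattice_ab_group_add"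
proof -
  have "w = pprt w - pprt (- w)" using prts[of w] by (simp add: pprt_neg)
  then have "pprt w - inf (pprt w) (pprt (- w)) = pprt w"
    unfolding diff_inf_eq_pos by (simp add: pprt_def)
  then show ?thesis by (simp only: diff_eq_eq) simp
qed

text \<open>If every \<open>x n\<close> is positive, the negative part of the limit \<open>l\<close>
  is below \<open>\<bar>x n - l\<bar>\<close>, whose norm tends to 0.\<close>

lemma closed_nonneg: "closed {x :: 'a::banach_lattice. 0 \<le> x}"
  unfolding closed_sequential_limits
proof (intro allI impI, elim conjE)
  fix x :: "nat \<Rightarrow> 'a" and l
  assume pos: "\<forall>n. x n \<in> {x. 0 \<le> x}" and lim: "x \<longlonglongrightarrow> l"
  have "norm (pprt (- l)) \<le> norm (x n - l)" for n
  proof (rule order_trans[OF norm_mono_pos])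
    have "- l \<le> x n - l" using pos by simp
    also have "\<dots> \<le> \<bar>x n - l\<bar>" by (rule abs_ge_self)
    finally show "pprt (- l) \<le> \<bar>x n - l\<bar>" by (simp add: pprt_def)
  qed auto
  moreover have "(\<lambda>n. norm (x n - l)) \<longlonglongrightarrow> 0"
    using tendsto_norm[OF LIM_zero[OF lim]] by simp
  ultimately have "norm (pprt (- l)) \<le> 0"
    by (intro tendsto_lowerbound[where F = sequentially]) auto
  then have "pprt (- l) = 0" by simp
  then show "l \<in> {x. 0 \<le> x}" by (simp add: pprt_neg zero_le_iff_zero_nprt)
qed

lemma pprt_scaleR: "0 < c \<Longrightarrow> pprt (c *\<^sub>R a) = c *\<^sub>R pprt a" for a :: "'a::banach_lattice"
proof -
  assume c: "0 < c"
  have "pprt (c *\<^sub>R a) = - inf (c *\<^sub>R (- a)) (c *\<^sub>R 0)" by (simp add: pprt_def)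
  also have "\<dots> = - (c *\<^sub>R inf (- a) 0)" by (simp only: inf_scaleR[OF c])
  also have "\<dots> = c *\<^sub>R pprt a" by (simp only: pprt_def flip: scaleR_minus_right) simp
  finally show ?thesis .
qed

text \<open>Since \<open>1 / c \<le> C\<close>, the second element is below a multiple of the
  negative part of \<open>a - c *\<^sub>R b\<close>, which is disjoint from the positive
  part.\<close>

lemma diff_pprt_disjoint:
  fixes a b :: "'a::banach_lattice"
  assumes c: "0 < c" and C: "1 \<le> c * C" and a: "0 \<le> a"
  shows "inf (pprt (a - c *\<^sub>R b)) (pprt (b - C *\<^sub>R a)) = 0"
proof (rule antisym)
  have "1 / c \<le> C" using c C by (simp add: field_simps)
  then have "b - C *\<^sub>R a \<le> b - (1 / c) *\<^sub>R a"
    using a by (intro diff_left_mono scaleR_right_mono)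
  also have "\<dots> = (1 / c) *\<^sub>R - (a - c *\<^sub>R b)" using c by (simp add: scaleR_diff_right)
  finally have "pprt (b - C *\<^sub>R a) \<le> (1 / c) *\<^sub>R pprt (- (a - c *\<^sub>R b))"
    using c by (metis pprt_mono pprt_scaleR zero_less_divide_1_iff)
  then have "inf (pprt (a - c *\<^sub>R b)) (pprt (b - C *\<^sub>R a))
      \<le> inf (1 *\<^sub>R pprt (a - c *\<^sub>R b)) ((1 / c) *\<^sub>R pprt (- (a - c *\<^sub>R b)))"
    by (intro inf_mono) auto
  also have "\<dots> = 0" using c by (intro inf_scaleR_eq_0 pprt_disjoint) auto
  finally show "inf (pprt (a - c *\<^sub>R b)) (pprt (b - C *\<^sub>R a)) \<le> 0" .
qed simp

lemma term_le_suminf: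
  fixes f :: "nat \<Rightarrow> 'a::banach_lattice"
  assumes f: "summable f" and pos: "\<And>n. 0 \<le> f n"
  shows "f i \<le> suminf f"
proof -
  have "(\<lambda>n. (\<Sum>j<n. f j) - f i) \<longlonglongrightarrow> suminf f - f i"
    by (intro tendsto_intros summable_LIMSEQ f)
  moreover have "\<forall>\<^sub>F n in sequentially. (\<Sum>j<n. f j) - f i \<in> {x. 0 \<le> x}"
    using eventually_gt_at_top[of i]
  proof eventually_elim
    case (elim n)
    then have "sum f {i} \<le> (\<Sum>j<n. f j)" by (intro sum_mono2) (auto simp: pos)
    then show ?case by simp
  qed
  ultimately have "suminf f - f i \<in> {x. 0 \<le> x}"
    by (intro Lim_in_closed_set[OF closed_nonneg _ trivial_limit_sequentially])
  then show ?thesis by simp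
qed

text \<open>If no \<open>u\<close> works, elements \<open>X j\<close> can be chosen so that the
  excess of \<open>X j\<close> over \<open>4 ^ j\<close> times the sum of the earlier ones has an
  image of norm above \<open>e\<close>. Subtracting also a small multiple of a common bound
  \<open>Y\<close> makes the excesses disjoint, against M-weak compactness.\<close>

lemma M_weakly_compact_almost_order_bounded:
  fixes T :: "'a::banach_lattice \<Rightarrow>\<^sub>L 'b::banach" and x :: "nat \<Rightarrow> 'a"
  assumes M: "M_weakly_compact T" and bd: "bounded (range x)" and pos: "\<And>n. 0 \<le> x n" and e: "0 < e"
  shows "\<exists>u\<ge>0. \<forall>n. norm (blinfun_apply T (pprt (x n - u))) \<le> e"
proof (rule ccontr)
  assume "\<not> ?thesis"
  then have bad: "\<exists>n. e < norm (blinfun_apply T (pprt (x n - u)))" if "0 \<le> u" for u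
    using that by (meson not_le)
  \<comment> \<open>A state consists of the sum of the elements chosen so far and the index of the
    latest choice.\<close>
  define P where "P j s \<longleftrightarrow> 0 \<le> fst s \<and> (j = 0 \<longrightarrow> fst s = 0)" for j :: nat and s :: "'a \<times> nat"
  define Q where "Q j s s' \<longleftrightarrow> fst s' = fst s + x (snd s') \<and>
    e < norm (blinfun_apply T (pprt (x (snd s') - (4 ^ j) *\<^sub>R fst s)))" for j and s s' :: "'a \<times> nat"
  have "\<exists>g. \<forall>n. P n (g n) \<and> Q n (g n) (g (Suc n))"
  proof (rule dependent_nat_choice)
    show "\<exists>s. P 0 s" by (intro exI[of _ "(0, 0)"]) (simp add: P_def)
    fix s j assume s: "P j s"
    then have "0 \<le> (4 ^ j) *\<^sub>R fst s" by (auto simp: P_def intro: scaleR_nonneg_nonneg)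
    then obtain n where "e < norm (blinfun_apply T (pprt (x n - (4 ^ j) *\<^sub>R fst s)))"
      using bad by blast
    then show "\<exists>s'. P (Suc j) s' \<and> Q j s s'"
      using s pos[of n] by (intro exI[of _ "(fst s + x n, n)"]) (simp add: P_def Q_def)
  qed
  then obtain g where g: "\<And>n. P n (g n)" "\<And>n. Q n (g n) (g (Suc n))" by blast
  define X where "X j = x (snd (g (Suc j)))" for j
  define s where "s j = fst (g j)" for j
  have X_pos: "0 \<le> X j" for j by (simp add: X_def pos)
  have s_Suc: "s (Suc j) = s j + X j" and big: "e < norm (blinfun_apply T (pprt (X j - (4 ^ j) *\<^sub>R s j)))" for j
    using g(2)[of j] by (simp_all add: Q_def X_def s_def)
  have "s 0 = 0" using g(1)[of 0] by (simp add: P_def s_def)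
  then have s_eq: "s j = (\<Sum>i<j. X i)" for j by (induction j) (simp_all add: s_Suc)
  obtain B where B: "\<And>n. norm (x n) \<le> B" using bd by (auto simp: bounded_iff)
  then have XB: "norm (X j) \<le> B" for j by (simp add: X_def)
  \<comment> \<open>One element that dominates \<open>(1/2) ^ j *\<^sub>R X j\<close> for all
    \<open>j\<close> at once, so that an earlier \<open>z i\<close> can be made disjoint from all
    later ones.\<close>
  define Y where "Y = (\<Sum>j. (1/2) ^ j *\<^sub>R X j)"
  have summable: "summable (\<lambda>j. (1/2) ^ j *\<^sub>R X j)"
  proof (rule summable_comparison_test')
    show "summable (\<lambda>j. B * (1/2) ^ j :: real)" by (intro summable_mult summable_geometric) simp
    show "norm ((1/2) ^ j *\<^sub>R X j) \<le> B * (1/2) ^ j" for j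
      using XB[of j] by (simp add: field_simps)
  qed
  have Y: "(1/2) ^ j *\<^sub>R X j \<le> Y" for j
    unfolding Y_def by (rule term_le_suminf[OF summable]) (auto intro: scaleR_nonneg_nonneg X_pos)
  have Y_pos: "0 \<le> Y" using Y[of 0] X_pos[of 0] by simp
  define z where "z j = pprt (X j - (4 ^ j) *\<^sub>R s j - (1/2) ^ j *\<^sub>R Y)" for j
  have s_pos: "0 \<le> s j" for j by (simp add: s_eq sum_nonneg X_pos)
  have z_pos: "0 \<le> z j" for j by (simp add: z_def)
  have z_le: "z j \<le> X j" for j
  proof -
    have "0 \<le> (4 ^ j) *\<^sub>R s j" "0 \<le> (1/2) ^ j *\<^sub>R Y"
      by (auto intro!: scaleR_nonneg_nonneg s_pos Y_pos)
    then have "X j - (4 ^ j) *\<^sub>R s j - (1/2) ^ j *\<^sub>R Y \<le> X j"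
      by (simp add: diff_le_eq add_increasing add_increasing2)
    then show ?thesis unfolding z_def pprt_def using X_pos by simp
  qed
  \<comment> \<open>The term with \<open>Y\<close> controls \<open>z i\<close> against the later
    \<open>X j\<close>, the term with \<open>s j\<close> controls \<open>z j\<close> against the
    earlier \<open>X i\<close>. The product of the factors \<open>(1/2) ^ (i + j)\<close> and
    \<open>4 ^ j\<close> is at least 1 because \<open>i < j\<close>.\<close>
  have disj: "inf (z i) (z j) = 0" if "i < j" for i j
  proof (rule antisym)
    have "(1/2) ^ (i + j) *\<^sub>R X j = (1/2) ^ i *\<^sub>R (1/2) ^ j *\<^sub>R X j" by (simp add: power_add)
    also have "\<dots> \<le> (1/2) ^ i *\<^sub>R Y" by (intro scaleR_left_mono Y) simp
    finally have "z i \<le> pprt (X i - (1/2) ^ (i + j) *\<^sub>R X j)"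
      using s_pos[of i] unfolding z_def
      by (intro pprt_mono) (simp add: algebra_simps add_increasing scaleR_nonneg_nonneg add_mono)
    moreover have "z j \<le> pprt (X j - (4 ^ j) *\<^sub>R X i)"
    proof -
      have "sum X {i} \<le> s j" unfolding s_eq using that by (intro sum_mono2) (auto simp: X_pos)
      then have "(4 ^ j) *\<^sub>R X i \<le> (4 ^ j) *\<^sub>R s j" by (intro scaleR_left_mono) auto
      moreover have "0 \<le> (1/2) ^ j *\<^sub>R Y" by (intro scaleR_nonneg_nonneg Y_pos) simp
      ultimately show ?thesis unfolding z_def
        by (intro pprt_mono) (simp add: algebra_simps add_increasing2)
    qed
    ultimately have "inf (z i) (z j) \<le> inf (pprt (X i - (1/2) ^ (i + j) *\<^sub>R X j)) (pprt (X j - (4 ^ j) *\<^sub>R X i))"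
      by (intro inf_mono)
    also have "\<dots> = 0"
    proof (rule diff_pprt_disjoint)
      have "(2::real) ^ (i + j) \<le> 2 ^ (j + j)" using that by (intro power_increasing) auto
      also have "\<dots> = 4 ^ j" by (simp add: power_add flip: power_mult_distrib)
      finally show "1 \<le> (1/2) ^ (i + j) * (4::real) ^ j" by (simp add: field_simps)
    qed (simp_all add: X_pos)
    finally show "inf (z i) (z j) \<le> 0" .
  qed (simp add: z_pos)
  have "disjoint_seq z"
    unfolding disjoint_seq_def
  proof (intro allI impI)
    fix i j :: nat assume "i \<noteq> j"
    then show "inf \<bar>z i\<bar> \<bar>z j\<bar> = 0"
      using disj[of i j] disj[of j i] z_pos by (cases "i < j") (auto simp: inf_commute)
  qed
  moreover have "norm (z j) \<le> B" for j
    using norm_mono_pos[OF z_pos z_le] XB by (rule order_trans)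
  then have "bounded (range z)" by (auto simp: bounded_iff)
  ultimately have "(\<lambda>j. norm (blinfun_apply T (z j))) \<longlonglongrightarrow> 0"
    using M by (auto simp: M_weakly_compact_def)
  moreover have "(\<lambda>j. norm T * ((1/2) ^ j * norm Y)) \<longlonglongrightarrow> norm T * (0 * norm Y)"
    by (intro tendsto_intros LIMSEQ_power_zero) simp
  ultimately have "(\<lambda>j. norm (blinfun_apply T (z j)) + norm T * ((1/2) ^ j * norm Y)) \<longlonglongrightarrow> 0 + norm T * (0 * norm Y)"
    by (rule tendsto_add)
  \<comment> \<open>Subtracting \<open>(1/2) ^ j *\<^sub>R Y\<close> inside a positive part changes
    it by at most that amount, so the image changes by a null sequence.\<close>
  moreover have "e \<le> norm (blinfun_apply T (z j)) + norm T * ((1/2) ^ j * norm Y)" for j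
  proof -
    define w where "w = X j - (4 ^ j) *\<^sub>R s j"
    define d where "d = (1/2) ^ j *\<^sub>R Y"
    have d: "0 \<le> d" unfolding d_def by (intro scaleR_nonneg_nonneg Y_pos) simp
    have "pprt w \<le> pprt (w - d) + d"
      unfolding pprt_def using d by (auto simp: add_sup_distrib_right intro: le_supI2)
    moreover have "pprt (w - d) \<le> pprt w" using d by (intro pprt_mono) simp
    ultimately have "norm (pprt w - pprt (w - d)) \<le> norm d"
      by (intro norm_mono_pos) (simp_all add: algebra_simps)
    then have "norm T * norm (pprt w - pprt (w - d)) \<le> norm T * norm d"
      by (intro mult_left_mono) auto
    then have "norm (blinfun_apply T (pprt w) - blinfun_apply T (pprt (w - d))) \<le> norm T * norm d"
      using norm_blinfun[of T "pprt w - pprt (w - d)"] by (simp add: blinfun.diff_right)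
    moreover have "norm (blinfun_apply T (pprt w)) \<le> norm (blinfun_apply T (pprt (w - d)))
        + norm (blinfun_apply T (pprt w) - blinfun_apply T (pprt (w - d)))"
      by (rule norm_triangle_sub)
    moreover have "z j = pprt (w - d)" by (simp add: z_def w_def d_def)
    moreover have "e < norm (blinfun_apply T (pprt w))" using big[of j] by (simp add: w_def)
    moreover have "norm d = (1/2) ^ j * norm Y" by (simp add: d_def)
    ultimately show ?thesis by simp
  qed
  ultimately have "e \<le> 0 + norm T * (0 * norm Y)"
    by (intro tendsto_lowerbound[where F = sequentially]) auto
  with e show False by simp
qed

section \<open>Unbounded absolute weakly null sequences under M-weakly compact operators\<close>

lemma M_weakly_compact_uaw_pos:
  fixes T :: "'a::banach_lattice \<Rightarrow>\<^sub>L c0" and y :: "nat \<Rightarrow> 'a"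
  assumes sigma: "sigma_dedekind_complete TYPE('a)" and M: "M_weakly_compact T"
    and bd: "bounded (range y)" and pos: "\<And>n. 0 \<le> y n"
    and weak: "\<And>u. 0 \<le> u \<Longrightarrow> weakly_tendsto (\<lambda>n. inf (y n) u) 0"
  shows "(\<lambda>n. blinfun_apply T (y n)) \<longlonglongrightarrow> 0"
proof (rule LIMSEQ_I)
  fix e :: real assume e: "0 < e"
  obtain u where u: "0 \<le> u" "\<And>n. norm (blinfun_apply T (pprt (y n - u))) \<le> e / 2"
    using M_weakly_compact_almost_order_bounded[OF M bd pos, of "e / 2"] e by auto
  have "(\<lambda>n. blinfun_apply T (inf (y n) u)) \<longlonglongrightarrow> 0"
    by (rule order_bounded_weakly_null[OF sigma weak[OF u(1)], of u]) (auto simp: pos u)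
  from LIMSEQ_D[OF this, of "e / 2"] e
  obtain N where N: "\<And>n. n \<ge> N \<Longrightarrow> norm (blinfun_apply T (inf (y n) u)) < e / 2" by auto
  have "norm (blinfun_apply T (y n) - 0) < e" if "n \<ge> N" for n
  proof -
    have "y n = inf (y n) u + pprt (y n - u)"
      using diff_inf_eq_pos[of "y n" u] by (simp only: pprt_def diff_eq_eq add.commute)
    then have "blinfun_apply T (y n) = blinfun_apply T (inf (y n) u) + blinfun_apply T (pprt (y n - u))"
      by (metis blinfun.add_right)
    then show ?thesis
      using u(2)[of n] N[OF that] norm_triangle_ineq[of "blinfun_apply T (inf (y n) u)" "blinfun_apply T (pprt (y n - u))"]
      by simp
  qed
  then show "\<exists>N. \<forall>n\<ge>N. norm (blinfun_apply T (y n) - 0) < e" by blast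
qed

text \<open>The positive and negative parts of \<open>x n\<close> lie below
  \<open>\<bar>x n\<bar>\<close>, so by \<open>weakly_null_dominated\<close> their truncations are
  weakly null and the positive case applies to each.\<close>

lemma M_weakly_compact_imp_uaw_Dunford_Pettis:
  fixes T :: "'a::banach_lattice \<Rightarrow>\<^sub>L c0"
  assumes sigma: "sigma_dedekind_complete TYPE('a)" and M: "M_weakly_compact T"
  shows "uaw_Dunford_Pettis T"
  unfolding uaw_Dunford_Pettis_def
proof (intro allI impI)
  fix x :: "nat \<Rightarrow> 'a"
  assume bd: "bounded (range x)" and uaw: "uaw_tendsto x 0"
  have part: "(\<lambda>n. blinfun_apply T (y n)) \<longlonglongrightarrow> 0"
    if y: "\<And>n. 0 \<le> y n" "\<And>n. y n \<le> \<bar>x n\<bar>" for y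
  proof (rule M_weakly_compact_uaw_pos[OF sigma M _ y(1)])
    obtain B where "\<And>n. norm (x n) \<le> B" using bd by (auto simp: bounded_iff)
    moreover have "norm (y n) \<le> norm (x n)" for n
      using norm_mono_pos[OF y] by simp
    ultimately show "bounded (range y)" by (auto simp: bounded_iff intro: order_trans)
    fix u :: 'a assume u: "0 \<le> u"
    show "weakly_tendsto (\<lambda>n. inf (y n) u) 0"
    proof (rule weakly_null_dominated)
      show "weakly_tendsto (\<lambda>n. inf \<bar>x n - 0\<bar> u) 0"
        using uaw u by (simp only: uaw_tendsto_def)
      have "\<bar>inf (y n) u\<bar> = inf (y n) u" for n using y(1) u by (intro abs_of_nonneg) simp
      then show "\<bar>inf (y n) u\<bar> \<le> inf \<bar>x n - 0\<bar> u" for n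
        using y(2)[of n] by (simp add: le_infI1)
    qed
  qed
  have "pprt a \<le> \<bar>a\<bar>" for a :: 'a by (simp add: pprt_def abs_ge_self)
  from part[of "\<lambda>n. pprt (x n)", OF _ this] part[of "\<lambda>n. pprt (- x n)"] this[of "- x n" for n]
  have "(\<lambda>n. blinfun_apply T (pprt (x n)) - blinfun_apply T (pprt (- x n))) \<longlonglongrightarrow> 0 - 0"
    by (intro tendsto_diff) auto
  moreover have "blinfun_apply T (x n) = blinfun_apply T (pprt (x n)) - blinfun_apply T (pprt (- x n))" for n
    using prts[of "x n"] by (simp add: pprt_neg flip: blinfun.diff_right)
  ultimately show "(\<lambda>n. norm (blinfun_apply T (x n))) \<longlonglongrightarrow> 0"
    by (simp add: tendsto_norm_zero)
qed

theorem theorem3p3: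
  assumes "sigma_dedekind_complete TYPE('a::banach_lattice)"
  shows "(disjoint_weak_star_DP TYPE('a) \<longleftrightarrow> (\<forall>T :: 'a \<Rightarrow>\<^sub>L c0. M_weakly_compact T)) \<and>
         ((\<forall>T :: 'a \<Rightarrow>\<^sub>L c0. M_weakly_compact T) \<longleftrightarrow> (\<forall>T :: 'a \<Rightarrow>\<^sub>L c0. uaw_Dunford_Pettis T))"
  using DP_imp_M_weakly_compact M_weakly_compact_imp_DP uaw_Dunford_Pettis_imp_M_weakly_compact
    M_weakly_compact_imp_uaw_Dunford_Pettis[OF assms] by blast

end
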